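(* There is a universal constant $C$ such that the following holds. Let $D$ be any (admissible) concave delay function, let $f$ be a piece-wise linear function with exponentially decreasing slopes satisfying $f(x)\le D(x)\le 2f(x)$ for all $x\ge 0$, and let SLA be the Single-Location-Algorithm run with the counters defined by $f$. Then for every instance of Single Location Concave MPMD (a finite even number of requests arriving online at a single location), the total delay cost (measured with $D$) of the matching produced by SLA is at most $C$ times the cost of an optimal offline perfect matching. That is, the deterministic online algorithm SLA is $O(1)$-competitive for any concave delay function.
   Context: Admissible delay function: $D:[0,\infty)\to[0,\infty)$ with $D(0)=0$, concave, continuous, monotonically increasing, with all one-sided derivatives positive and bounded, and $\lim_{t\to\infty}D(t)=\infty$. Single Location Concave MPMD: a finite, even number of requests arrive over time; request $r$ arrives at time $a(r)\ge 0$. At any time an algorithm may irrevocably match any two arrived, unmatched requests; all requests must eventually be matched. If $r$ is matched at time $m(r)\ge a(r)$, it incurs delay cost $D(m(r)-a(r))$. The cost of a solution is $\sum_r D(m(r)-a(r))$. An online algorithm's decisions at time $t$ depend only on requests arrived by time $t$. The optimal offline solution minimizes the cost knowing the whole instance. An algorithm is $c$-competitive if its cost is at most $c$ times the optimum on every instance. Piece-wise linear function with exponentially decreasing slopes: $f$ is continuous with $f(0)=0$, and there are $0=x_0<x_1<x_2<\dots$ such that on the $k$-th piece $[x_{k-1},x_k)$ ($k=1,2,\dots$) $f$ is linear with slope $\alpha_k>0$, where $\alpha_k\ge 2\alpha_{k+1}$; either there are finitely many pieces $k=1,\dots,d$ with $x_d=\infty$, or infinitely many with $x_k\to\infty$.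 Put $y_k=\alpha_k(x_k-x_{k-1})$ (possibly $y_d=\infty$ for a last piece). Algorithm SLA: there is one counter $z_k$ for each linear piece $k$, with capacity $y_k$ and slope $\alpha_k$, initially at value $0$. An arriving request is associated with $z_1$. Whenever a counter has two requests associated with it, these two are matched to each other and removed. At every time, simultaneously for all $k$, the value of $z_k$ increases at rate $\alpha_k$ if and only if (1) there is a request associated with $z_k$, and (2) the total number of requests associated with $z_1,\dots,z_{k-1}$ is even; otherwise it stays constant. When $z_k$ reaches its capacity $y_k$, its associated request is moved to (becomes associated with) $z_{k+1}$ and the value of $z_k$ is reset to $0$ (the value of $z_{k+1}$ is not reset by this). If a counter reaches capacity at the same instant at which a request arrives, the move is performed first. *)

theory Defs
  imports "HOL-Analysis.Analysis"
begin

definition admissible_delay :: "(real \<Rightarrow> real) \<Rightarrow> bool" where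
  "admissible_delay D \<longleftrightarrow>
     D \<in> {0..} \<rightarrow> {0..} \<and> D 0 = 0 \<and> concave_on {0..} D \<and> continuous_on {0..} D \<and>
     mono_on {0..} D \<and>
     (\<exists>B. (\<forall>t\<ge>0. \<exists>d. (D has_real_derivative d) (at_right t) \<and> 0 < d \<and> d \<le> B) \<and>
          (\<forall>t>0. \<exists>d. (D has_real_derivative d) (at_left t) \<and> 0 < d \<and> d \<le> B)) \<and>
     filterlim D at_top at_top"


subsection \<open>Piecewise linear functions with exponentially decreasing slopes\<close>

text \<open>
  The number of pieces is \<open>d\<close>, possibly infinite. Pieces are numbered from 1;
  piece \<open>k\<close> is \<open>[x (k - 1), x k)\<close> with slope \<open>\<alpha> k\<close>. The values of \<open>x\<close> and \<open>\<alpha>\<close>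
  beyond \<open>d\<close> and the value \<open>\<alpha> 0\<close> are irrelevant. Strict monotonicity makes
  \<open>x k\<close> finite for all \<open>k < d\<close>.
\<close>

definition pieces :: "enat \<Rightarrow> nat set" where
  "pieces d = {k. 1 \<le> k \<and> enat k \<le> d}"

definition exp_decreasing_pwl ::
    "enat \<Rightarrow> (nat \<Rightarrow> ereal) \<Rightarrow> (nat \<Rightarrow> real) \<Rightarrow> (real \<Rightarrow> real) \<Rightarrow> bool" where
  "exp_decreasing_pwl d x \<alpha> f \<longleftrightarrow>
     1 \<le> d \<and> x 0 = 0 \<and>
     (\<forall>k\<in>pieces d. x (k - 1) < x k) \<and>
     (case d of enat l \<Rightarrow> x l = \<infinity> | \<infinity> \<Rightarrow> x \<longlonglongrightarrow> \<infinity>) \<and>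
     (\<forall>k\<in>pieces d. 0 < \<alpha> k) \<and>
     (\<forall>k. k \<in> pieces d \<and> Suc k \<in> pieces d \<longrightarrow> \<alpha> k \<ge> 2 * \<alpha> (Suc k)) \<and>
     f 0 = 0 \<and> continuous_on {0..} f \<and>
     (\<forall>k\<in>pieces d. \<forall>s t. x (k - 1) \<le> ereal s \<and> s \<le> t \<and> ereal t < x k
        \<longrightarrow> f t - f s = \<alpha> k * (t - s))"

definition capacity :: "(nat \<Rightarrow> ereal) \<Rightarrow> (nat \<Rightarrow> real) \<Rightarrow> nat \<Rightarrow> ereal" where
  "capacity x \<alpha> k = ereal (\<alpha> k) * (x k - x (k - 1))"


subsection \<open>Instances, solutions and their cost\<close>

text \<open>
  An instance is a number \<open>n\<close> of requests \<open>0, \<dots>, n - 1\<close> with arrival times \<open>a\<close>;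
  the numbering carries no information about the order of arrival. A solution
  consists of a partner \<open>p r\<close> and a matching time \<open>m r\<close> for every request \<open>r\<close>.
\<close>

definition mpmd_instance :: "nat \<Rightarrow> (nat \<Rightarrow> real) \<Rightarrow> bool" where
  "mpmd_instance n a \<longleftrightarrow> even n \<and> (\<forall>r<n. 0 \<le> a r)"

definition solution :: "nat \<Rightarrow> (nat \<Rightarrow> real) \<Rightarrow> (nat \<Rightarrow> nat) \<Rightarrow> (nat \<Rightarrow> real) \<Rightarrow> bool" where
  "solution n a p m \<longleftrightarrow>
     (\<forall>r<n. p r < n \<and> p r \<noteq> r \<and> p (p r) = r \<and> m (p r) = m r \<and> a r \<le> m r)"

definition cost :: "(real \<Rightarrow> real) \<Rightarrow> nat \<Rightarrow> (nat \<Rightarrow> real) \<Rightarrow> (nat \<Rightarrow> real) \<Rightarrow> real" where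
  "cost D n a m = (\<Sum>r<n. D (m r - a r))"

text \<open>
  For instances and nonnegative \<open>D\<close> the set below is nonempty and bounded below.
\<close>

definition opt_cost :: "(real \<Rightarrow> real) \<Rightarrow> nat \<Rightarrow> (nat \<Rightarrow> real) \<Rightarrow> real" where
  "opt_cost D n a = Inf {cost D n a m | p m. solution n a p m}"


subsection \<open>The Single-Location-Algorithm\<close>

text \<open>
  The algorithm is a hybrid transition system: discrete steps take no time and have
  priority over the passage of time. \<open>At k\<close> means associated with counter \<open>k\<close>;
  \<open>Matched r t\<close> means matched with \<open>r\<close> at time \<open>t\<close>. The order in which simultaneous
  arrivals (and simultaneous moves) are processed is left open.
\<close>

datatype status = Pending | At nat | Matched nat real

record sla_state =
  now :: real
  status :: "nat \<Rightarrow> status"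
  counter :: "nat \<Rightarrow> real"

definition sla_init :: sla_state where
  "sla_init = \<lparr>now = 0, status = (\<lambda>_. Pending), counter = (\<lambda>_. 0)\<rparr>"

definition match_due :: "sla_state \<Rightarrow> bool" where
  "match_due s \<longleftrightarrow> (\<exists>k r r'. r \<noteq> r' \<and> status s r = At k \<and> status s r' = At k)"

definition move_due :: "(nat \<Rightarrow> ereal) \<Rightarrow> (nat \<Rightarrow> real) \<Rightarrow> sla_state \<Rightarrow> bool" where
  "move_due x \<alpha> s \<longleftrightarrow> (\<exists>k r. status s r = At k \<and> ereal (counter s k) = capacity x \<alpha> k)"

definition active :: "sla_state \<Rightarrow> nat \<Rightarrow> bool" where
  "active s k \<longleftrightarrow>
     (\<exists>r. status s r = At k) \<and> even (card {r. \<exists>j\<in>{1..<k}. status s r = At j})"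

text \<open>
  In rule \<open>elapse\<close> no discrete event happens strictly before time \<open>now s + \<delta>\<close>, so the set of
  active counters is constant on that time interval.
\<close>

inductive sla_step ::
    "(nat \<Rightarrow> ereal) \<Rightarrow> (nat \<Rightarrow> real) \<Rightarrow> nat \<Rightarrow> (nat \<Rightarrow> real) \<Rightarrow> sla_state \<Rightarrow> sla_state \<Rightarrow> bool"
  for x :: "nat \<Rightarrow> ereal" and \<alpha> :: "nat \<Rightarrow> real" and n :: nat and a :: "nat \<Rightarrow> real"
where
  match: "sla_step x \<alpha> n a s
      (s\<lparr>status := (status s)(r := Matched r' (now s), r' := Matched r (now s))\<rparr>)"
    if "r \<noteq> r'" "status s r = At k" "status s r' = At k"
| move: "sla_step x \<alpha> n a s
      (s\<lparr>status := (status s)(r := At (Suc k)), counter := (counter s)(k := 0)\<rparr>)"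
    if "\<not> match_due s" "status s r = At k" "ereal (counter s k) = capacity x \<alpha> k"
| arrive: "sla_step x \<alpha> n a s (s\<lparr>status := (status s)(r := At 1)\<rparr>)"
    if "\<not> match_due s" "\<not> move_due x \<alpha> s" "r < n" "status s r = Pending" "a r = now s"
| elapse: "sla_step x \<alpha> n a s
      (s\<lparr>now := now s + \<delta>,
         counter := (\<lambda>k. if active s k then counter s k + \<alpha> k * \<delta> else counter s k)\<rparr>)"
    if "\<not> match_due s" "\<not> move_due x \<alpha> s" "0 < \<delta>"
       "\<forall>r<n. status s r = Pending \<longrightarrow> now s + \<delta> \<le> a r"
       "\<forall>k. active s k \<longrightarrow> ereal (counter s k + \<alpha> k * \<delta>) \<le> capacity x \<alpha> k"

definition sla_reachable ::
    "(nat \<Rightarrow> ereal) \<Rightarrow> (nat \<Rightarrow> real) \<Rightarrow> nat \<Rightarrow> (nat \<Rightarrow> real) \<Rightarrow> sla_state \<Rightarrow> bool" where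
  "sla_reachable x \<alpha> n a s \<longleftrightarrow> (sla_step x \<alpha> n a)\<^sup>*\<^sup>* sla_init s"

definition sla_result :: "nat \<Rightarrow> sla_state \<Rightarrow> (nat \<Rightarrow> nat) \<Rightarrow> (nat \<Rightarrow> real) \<Rightarrow> bool" where
  "sla_result n s p m \<longleftrightarrow> (\<forall>r<n. status s r = Matched (p r) (m r))"

text \<open>
  No run can get stuck: every reachable state leads to one where all requests are matched.
\<close>

definition sla_completes ::
    "(nat \<Rightarrow> ereal) \<Rightarrow> (nat \<Rightarrow> real) \<Rightarrow> nat \<Rightarrow> (nat \<Rightarrow> real) \<Rightarrow> bool" where
  "sla_completes x \<alpha> n a \<longleftrightarrow>
     (\<forall>s. sla_reachable x \<alpha> n a s \<longrightarrow>
        (\<exists>s' p m. (sla_step x \<alpha> n a)\<^sup>*\<^sup>* s s' \<and> sla_result n s' p m))"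

end

theory Submission
  imports Defs
begin

text \<open>
  Up to constants, \<open>f t\<close> is the sum over \<open>k\<close> of the truncated linear functions
  \<open>min (\<alpha>\<^sub>k t) y\<^sub>k\<close>, so the offline cost can be split among the counters. By tangents, a request
  at level \<open>k\<close> and of age \<open>t\<close> costs at most \<open>y\<^sub>1 + \<dots> + y\<^sub>k\<^sub>-\<^sub>1 + \<alpha>\<^sub>k t\<close>; the first part is paid by the
  moves, and the growth of the second part by the active counters, whose slopes dominate those of
  the paused ones. So the cost of the algorithm is at most three times the total increase of the
  counters.

  For a fixed \<open>k\<close>, call an offline pair long if its arrivals are at least \<open>y\<^sub>k / \<alpha>\<^sub>k\<close> apart.
  Counter \<open>k\<close> runs only if the number of arrivals minus the number of moves out of counter \<open>k\<close> is
  odd. Without long pairs, in every other period between two such moves the running counter implies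
  that a short offline pair is open, and this pays for two periods. The arrival of a request of a
  long pair shifts the parity but costs the offline solution \<open>y\<^sub>k / 2\<close>. Both bounds are invariants
  of a single state, so no history of the run is needed.
\<close>

section \<open>Piecewise linear functions\<close>

locale pwl =
  fixes d :: enat and x :: "nat \<Rightarrow> ereal" and \<alpha> :: "nat \<Rightarrow> real" and f :: "real \<Rightarrow> real"
  assumes pwl: "exp_decreasing_pwl d x \<alpha> f"
begin

text \<open>Both are 0 where the extended real is infinite; hence the recurring side conditions
  \<open>x k \<noteq> \<infinity>\<close> and
  \<open>capacity x \<alpha> k \<noteq> \<infinity>\<close>.\<close>

abbreviation X :: "nat \<Rightarrow> real" where "X k \<equiv> real_of_ereal (x k)"
abbreviation y :: "nat \<Rightarrow> real" where "y k \<equiv> real_of_ereal (capacity x \<alpha> k)"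

section \<open>Pieces, break points, slopes and capacities\<close>

lemma slope_pos: "k \<in> pieces d \<Longrightarrow> 0 < \<alpha> k"
  and slope_halves: "k \<in> pieces d \<Longrightarrow> Suc k \<in> pieces d \<Longrightarrow> 2 * \<alpha> (Suc k) \<le> \<alpha> k"
  and break_less: "k \<in> pieces d \<Longrightarrow> x (k - 1) < x k"
  and linear: "k \<in> pieces d \<Longrightarrow> x (k - 1) \<le> ereal s \<Longrightarrow> s \<le> t \<Longrightarrow> ereal t < x k
                 \<Longrightarrow> f t - f s = \<alpha> k * (t - s)"
  and x_0 [simp]: "x 0 = 0" and f_0 [simp]: "f 0 = 0"
  and f_continuous: "continuous_on {0..} f"
  using pwl unfolding exp_decreasing_pwl_def by auto

lemma pieces_1: "1 \<in> pieces d"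
  using pwl by (simp add: exp_decreasing_pwl_def pieces_def one_enat_def)

lemma pieces_ge_1: "k \<in> pieces d \<Longrightarrow> 1 \<le> k"
  by (simp add: pieces_def)

lemma pieces_down:
  assumes "k \<in> pieces d" "1 \<le> j" "j \<le> k"
  shows "j \<in> pieces d"
  using assms by (auto simp: pieces_def intro: order_trans[of "enat j" "enat k"])

lemma break_nonneg: "enat k \<le> d \<Longrightarrow> 0 \<le> x k"
proof (induction k)
  case (Suc k)
  then have "Suc k \<in> pieces d" "enat k \<le> d"
    by (auto simp: pieces_def intro: order_trans[of "enat k" "enat (Suc k)"])
  with Suc break_less[of "Suc k"] show ?case by simp
qed simp

lemma break_finite:
  assumes "k \<in> pieces d"
  shows "x (k - 1) = ereal (X (k - 1))" "0 \<le> X (k - 1)"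
proof -
  have "enat k \<le> d" using assms by (simp add: pieces_def)
  then have "enat (k - 1) \<le> d" by (rule order_trans[rotated]) simp
  then have "0 \<le> x (k - 1)" by (rule break_nonneg)
  then show "x (k - 1) = ereal (X (k - 1))" "0 \<le> X (k - 1)"
    using break_less[OF assms] by (cases "x (k - 1)"; auto)+
qed

lemma break_Suc:
  assumes "k \<in> pieces d" "Suc k \<in> pieces d"
  shows "x k = ereal (X k)" "X (k - 1) < X k"
proof -
  show k: "x k = ereal (X k)" using break_finite(1)[OF assms(2)] by simp
  obtain p q where "x (k - 1) = ereal p" "x k = ereal q"
    using break_finite(1)[OF assms(1)] k by blast
  then show "X (k - 1) < X k" using break_less[OF assms(1)] by simp
qed

lemma break_not_infinite: "Suc k \<in> pieces d \<Longrightarrow> x k \<noteq> \<infinity>"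
  using break_less[of "Suc k"] by auto

lemma capacity_eq:
  assumes "k \<in> pieces d"
  shows "capacity x \<alpha> k = (if x k = \<infinity> then \<infinity> else ereal (\<alpha> k * (X k - X (k - 1))))"
proof -
  obtain p where "x (k - 1) = ereal p" using break_finite(1)[OF assms] by blast
  then show ?thesis using break_less[OF assms] slope_pos[OF assms]
    by (cases "x k") (simp_all add: capacity_def)
qed

lemma y_eq: "k \<in> pieces d \<Longrightarrow> x k \<noteq> \<infinity> \<Longrightarrow> y k = \<alpha> k * (X k - X (k - 1))"
  by (simp add: capacity_eq)

lemma capacity_pos: "k \<in> pieces d \<Longrightarrow> 0 < capacity x \<alpha> k"
proof -
  assume k: "k \<in> pieces d"
  obtain p where "x (k - 1) = ereal p" using break_finite(1)[OF k] by blast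
  then have "X (k - 1) < X k" if "x k \<noteq> \<infinity>"
    using break_less[OF k] that by (cases "x k") auto
  then show ?thesis using slope_pos[OF k] by (simp add: capacity_eq[OF k])
qed

lemma y_nonneg: "k \<in> pieces d \<Longrightarrow> 0 \<le> y k"
  using capacity_pos by (simp add: less_imp_le real_of_ereal_pos)

lemma capacity_real: "k \<in> pieces d \<Longrightarrow> capacity x \<alpha> k \<noteq> \<infinity> \<Longrightarrow> capacity x \<alpha> k = ereal (y k)"
  using capacity_pos[of k] by (cases "capacity x \<alpha> k") auto

lemma capacity_iff:
  assumes "k \<in> pieces d" "capacity x \<alpha> k \<noteq> \<infinity>"
  shows "ereal t < capacity x \<alpha> k \<longleftrightarrow> t < y k" "ereal t \<le> capacity x \<alpha> k \<longleftrightarrow> t \<le> y k"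
    "ereal t = capacity x \<alpha> k \<longleftrightarrow> t = y k"
proof -
  obtain c where "capacity x \<alpha> k = ereal c" using capacity_real[OF assms] by blast
  then show "ereal t < capacity x \<alpha> k \<longleftrightarrow> t < y k" "ereal t \<le> capacity x \<alpha> k \<longleftrightarrow> t \<le> y k"
    "ereal t = capacity x \<alpha> k \<longleftrightarrow> t = y k" by simp_all
qed

lemma capacity_finite:
  assumes "Suc k \<in> pieces d" "1 \<le> k"
  shows "capacity x \<alpha> k \<noteq> \<infinity>"
  using assms break_not_infinite pieces_down[of "Suc k" k] by (simp add: capacity_eq)

text \<open>The last piece reaches to infinity, so a counter that can become full always has a
  successor for its request.\<close>

lemma Suc_pieces:
  assumes "k \<in> pieces d" "capacity x \<alpha> k \<noteq> \<infinity>"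
  shows "Suc k \<in> pieces d"
proof (rule ccontr)
  assume "Suc k \<notin> pieces d"
  with assms(1) have "d = enat k" by (cases d) (auto simp: pieces_def)
  then have "x k = \<infinity>" using pwl by (simp add: exp_decreasing_pwl_def)
  with assms show False by (simp add: capacity_eq)
qed

lemma slope_antimono:
  assumes "k \<in> pieces d" "1 \<le> j" "j \<le> k"
  shows "\<alpha> k \<le> \<alpha> j"
  using assms(3,1)
proof (induction rule: dec_induct)
  case (step i)
  then have "i \<in> pieces d" using assms(2) pieces_down[of "Suc i" i] by simp
  with step slope_halves[of i] slope_pos[of "Suc i"] show ?case by simp
qed simp

section \<open>Values of \<open>f\<close> and bounds by linear functions\<close>

lemma f_piece:
  assumes "k \<in> pieces d" "X (k - 1) \<le> t" "ereal t < x k"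
  shows "f t = f (X (k - 1)) + \<alpha> k * (t - X (k - 1))"
  using linear[OF assms(1), of "X (k - 1)" t] break_finite[OF assms(1)] assms by simp

text \<open>Linearity is assumed on half-open pieces only; the value at the right end comes from
  continuity, as the left limit of the affine function.\<close>

lemma f_break:
  assumes k: "k \<in> pieces d" "Suc k \<in> pieces d"
  shows "f (X k) = f (X (k - 1)) + y k"
proof -
  let ?g = "\<lambda>t. f (X (k - 1)) + \<alpha> k * (t - X (k - 1))"
  note b = break_Suc[OF k] break_finite[OF k(1)]
  have "continuous_on {X (k - 1)..X k} f"
    using f_continuous by (rule continuous_on_subset) (use b in auto)
  then have "(f \<longlongrightarrow> f (X k)) (at_left (X k))"
    using b by (intro continuous_on_Icc_at_leftD)
  moreover have "\<forall>\<^sub>F t in at_left (X k). f t = ?g t"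
    using eventually_at_left_real[OF b(2)]
  proof eventually_elim
    case (elim t)
    then have "ereal t < x k" by (subst b(1)) simp
    with elim f_piece[OF k(1), of t] show ?case by simp
  qed
  ultimately have "(?g \<longlongrightarrow> f (X k)) (at_left (X k))"
    by (rule Lim_transform_eventually)
  moreover have "(?g \<longlongrightarrow> ?g (X k)) (at_left (X k))"
    by (intro tendsto_intros)
  ultimately have "f (X k) = ?g (X k)"
    by (rule tendsto_unique[rotated]) simp
  then show ?thesis using y_eq[OF k(1)] break_not_infinite[OF k(2)] by simp
qed

lemma f_break_sum: "k \<in> pieces d \<Longrightarrow> f (X (k - 1)) = (\<Sum>i\<in>{1..<k}. y i)"
proof (induction k)
  case (Suc k)
  show ?case
  proof (cases "k = 0")
    case False
    then have "k \<in> pieces d" using Suc pieces_down[of "Suc k" k] by simp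
    with Suc False show ?thesis by (simp add: f_break atLeastLessThanSuc)
  qed simp
qed (simp add: pieces_def)

lemma ex_piece:
  assumes "0 \<le> t"
  obtains k where "k \<in> pieces d" "X (k - 1) \<le> t" "ereal t < x k"
proof -
  have "\<exists>k. enat k \<le> d \<and> ereal t < x k"
  proof (cases d)
    case (enat l)
    then have "x l = \<infinity>" using pwl by (simp add: exp_decreasing_pwl_def)
    then show ?thesis using enat by (intro exI[of _ l]) simp
  next
    case infinity
    then have "x \<longlonglongrightarrow> \<infinity>" using pwl by (simp add: exp_decreasing_pwl_def)
    then have "\<exists>k. ereal t < x k"
      using order_tendstoD(1)[of x \<infinity> sequentially "ereal t"]
      by (auto simp: eventually_sequentially)
    with infinity show ?thesis by simp
  qed
  then obtain k where k: "enat k \<le> d" "ereal t < x k"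
    and least: "\<And>j. j < k \<Longrightarrow> \<not> (enat j \<le> d \<and> ereal t < x j)"
    using exists_least_iff[of "\<lambda>k. enat k \<le> d \<and> ereal t < x k"] by blast
  have "k \<noteq> 0" using k(2) assms by (metis less_ereal.simps(1) not_less x_0 zero_ereal_def)
  with k have kp: "k \<in> pieces d" by (simp add: pieces_def)
  have "enat (k - 1) \<le> d" using k(1) by (metis diff_le_self enat_ord_simps(1) order_trans)
  with least[of "k - 1"] \<open>k \<noteq> 0\<close> have "x (k - 1) \<le> ereal t" by auto
  then have "X (k - 1) \<le> t" using break_finite(1)[OF kp] by (metis ereal_less_eq(3))
  with kp k that show ?thesis by blast
qed

lemma break_mono:
  assumes "k \<in> pieces d" "1 \<le> j" "j \<le> k"
  shows "X (j - 1) \<le> X (k - 1)"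
  using assms(3,1)
proof (induction rule: dec_induct)
  case (step i)
  then have "i \<in> pieces d" using assms(2) pieces_down[of "Suc i" i] by simp
  with step break_Suc[of i] show ?case by simp
qed simp

text \<open>Limits the counters that can be reached by a given time, both for termination and for
  keeping the sums over counters finite.\<close>

lemma levels_bounded:
  assumes "0 \<le> t"
  obtains K where "K \<in> pieces d" "\<And>k. k \<in> pieces d \<Longrightarrow> X (k - 1) \<le> t \<Longrightarrow> k \<le> K"
proof -
  obtain K where K: "K \<in> pieces d" "ereal t < x K" using ex_piece[OF assms] by blast
  have "k \<le> K" if "k \<in> pieces d" "X (k - 1) \<le> t" for k
  proof (rule ccontr)
    assume "\<not> k \<le> K"
    then have "Suc K \<in> pieces d" "X K \<le> X (k - 1)"
      using that pieces_down[of k "Suc K"] break_mono[of k "Suc K"] by auto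
    with K that break_Suc(1)[OF K(1)] show False by (metis less_ereal.simps(1) not_less order_trans)
  qed
  with K that show ?thesis by blast
qed

text \<open>From piece \<open>k\<close> on all slopes are at most \<open>\<alpha> k\<close>, so
  later break points lie below the prolongation of piece \<open>k\<close>.\<close>

lemma f_break_le:
  assumes "j \<in> pieces d" "1 \<le> k" "k \<le> j"
  shows "f (X (j - 1)) \<le> f (X (k - 1)) + \<alpha> k * (X (j - 1) - X (k - 1))"
  using assms(3,1)
proof (induction rule: dec_induct)
  case (step i)
  then have i: "i \<in> pieces d" using assms(2) pieces_down[of "Suc i" i] by simp
  have "x i \<noteq> \<infinity>" using break_not_infinite step.prems .
  then have "f (X i) = f (X (i - 1)) + \<alpha> i * (X i - X (i - 1))"
    using f_break[OF i step.prems] y_eq[OF i] by simp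
  also have "\<alpha> i * (X i - X (i - 1)) \<le> \<alpha> k * (X i - X (i - 1))"
    using break_Suc[OF i step.prems] slope_antimono[OF i assms(2)] step.hyps
    by (intro mult_right_mono) auto
  finally show ?case using step.IH[OF i] by (simp add: algebra_simps)
qed simp

text \<open>No slope on the way from 0 to \<open>t\<close> is below
  \<open>\<alpha> j\<close>.\<close>

lemma slope_mult_le:
  assumes "j \<in> pieces d" "X (j - 1) \<le> t" "ereal t < x j"
  shows "\<alpha> j * t \<le> f t"
proof -
  have "\<alpha> j * X (j - 1) \<le> f (X (j - 1))" using assms(1)
  proof (induction j)
    case (Suc j)
    show ?case
    proof (cases "j = 0")
      case False
      then have j: "j \<in> pieces d" using Suc pieces_down[of "Suc j" j] by simp
      have "x j \<noteq> \<infinity>" using break_not_infinite Suc.prems .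
      then have "f (X j) = f (X (j - 1)) + \<alpha> j * (X j - X (j - 1))"
        using f_break[OF j Suc.prems] y_eq[OF j] by simp
      moreover have "\<alpha> (Suc j) * X j \<le> \<alpha> j * X j"
        using break_finite[OF Suc.prems] slope_antimono[OF Suc.prems, of j] False
        by (intro mult_right_mono) auto
      ultimately show ?thesis using Suc.IH[OF j] by (simp add: algebra_simps)
    qed simp
  qed (simp add: pieces_def)
  then show ?thesis using f_piece[OF assms] by (simp add: algebra_simps)
qed

text \<open>From piece \<open>k\<close> on, \<open>f\<close> stays below the prolongation of piece
  \<open>k\<close>, and dropping the term \<open>- \<alpha> k * X (k - 1)\<close> only raises the
  bound. On earlier pieces the sum alone, which is \<open>f (X (k - 1))\<close>, suffices.\<close>

lemma f_tangent:
  assumes k: "k \<in> pieces d" and t: "0 \<le> t"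
  shows "f t \<le> (\<Sum>i\<in>{1..<k}. y i) + \<alpha> k * t"
proof -
  obtain j where j: "j \<in> pieces d" "X (j - 1) \<le> t" "ereal t < x j" using ex_piece[OF t] .
  note f = f_piece[OF j]
  show ?thesis
  proof (cases "k \<le> j")
    case True
    have "\<alpha> j * (t - X (j - 1)) \<le> \<alpha> k * (t - X (j - 1))"
      using j slope_antimono[OF j(1) pieces_ge_1[OF k] True] by (intro mult_right_mono) auto
    moreover have "0 \<le> \<alpha> k * X (k - 1)"
      using slope_pos[OF k] break_finite[OF k] by simp
    ultimately show ?thesis
      using f f_break_le[OF j(1) pieces_ge_1[OF k] True] f_break_sum[OF k] by (simp add: algebra_simps)
  next
    case False
    then have Sj: "Suc j \<in> pieces d" using k pieces_down[of k "Suc j"] by simp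
    have "t \<le> X j" using j break_Suc(1)[OF j(1) Sj] by (metis ereal_less_eq(3) less_imp_le)
    then have "\<alpha> j * (t - X (j - 1)) \<le> \<alpha> j * (X j - X (j - 1))"
      using slope_pos[OF j(1)] by (intro mult_left_mono) auto
    also have "\<dots> = y j" using break_not_infinite[OF Sj] y_eq[OF j(1)] by simp
    finally have "f t \<le> (\<Sum>i\<in>{1..<Suc j}. y i)"
      using f f_break_sum[OF Sj] f_break[OF j(1) Sj] by simp
    also have "\<dots> \<le> (\<Sum>i\<in>{1..<k}. y i)"
      using False k pieces_down[OF k] by (intro sum_mono2 y_nonneg) auto
    finally show ?thesis using slope_pos[OF k] t by (simp add: add_increasing2)
  qed
qed

text \<open>This is \<open>min (\<alpha> k * t) (y k)\<close>, written so that an infinite capacity,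
  where \<open>y k\<close> is 0, truncates nothing.\<close>

definition trunc :: "nat \<Rightarrow> real \<Rightarrow> real" where
  "trunc k t = (if capacity x \<alpha> k \<noteq> \<infinity> \<and> y k \<le> \<alpha> k * t then y k else \<alpha> k * t)"

text \<open>A geometric series; the subtracted last slope makes the induction close. The halving of
  the slopes, beyond their mere decrease, enters here.\<close>

lemma sum_slopes_le:
  assumes "j \<in> pieces d" "K \<in> pieces d" "j \<le> K"
  shows "(\<Sum>k\<in>{j..K}. \<alpha> k) \<le> 2 * \<alpha> j - \<alpha> K"
  using assms(3,2)
proof (induction rule: dec_induct)
  case (step i)
  then have "i \<in> pieces d" using assms(1) pieces_ge_1[OF assms(1)] pieces_down[of "Suc i" i] by simp
  with step slope_halves[of i] show ?case by simp
qed simp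

text \<open>For \<open>t\<close> in piece \<open>j\<close>, the counters below \<open>j\<close>
  contribute at most their capacities, in total \<open>f (X (j - 1)) \<le> f t\<close>. The others
  contribute at most \<open>\<alpha> k * t\<close> each, in total
  \<open>2 * \<alpha> j * t \<le> 2 * f t\<close>.\<close>

lemma sum_trunc_le:
  assumes K: "K \<in> pieces d" and t: "0 \<le> t"
  shows "(\<Sum>k\<in>{1..K}. trunc k t) \<le> 3 * f t"
proof -
  obtain j where j: "j \<in> pieces d" "X (j - 1) \<le> t" "ereal t < x j" using ex_piece[OF t] .
  have p: "k \<in> pieces d" if "k \<in> {1..K}" for k using that pieces_down[OF K] by simp
  have nn: "0 \<le> \<alpha> k" if "k \<in> {1..K}" for k using slope_pos[OF p[OF that]] by simp
  have low: "trunc k t \<le> y k" if "k \<in> {1..<j}" for k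
  proof -
    have "Suc k \<in> pieces d" using that pieces_down[OF j(1), of "Suc k"] by auto
    then have "capacity x \<alpha> k \<noteq> \<infinity>" using that capacity_finite by auto
    then show ?thesis by (auto simp: trunc_def)
  qed
  have high: "trunc k t \<le> \<alpha> k * t" for k by (auto simp: trunc_def)
  have yn: "0 \<le> y k" if "k \<in> {1..<j}" for k using that pieces_down[OF j(1)] y_nonneg by auto
  have "(\<Sum>k\<in>{1..K}. trunc k t) = (\<Sum>k\<in>{1..K} \<inter> {..<j}. trunc k t) + (\<Sum>k\<in>{1..K} - {..<j}. trunc k t)"
    by (rule sum.Int_Diff) simp
  also have "(\<Sum>k\<in>{1..K} \<inter> {..<j}. trunc k t) \<le> (\<Sum>k\<in>{1..K} \<inter> {..<j}. y k)"
    using low by (intro sum_mono) auto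
  also have "\<dots> \<le> (\<Sum>k\<in>{1..<j}. y k)"
    using yn by (intro sum_mono2) auto
  also have "\<dots> \<le> f t"
    using f_piece[OF j] f_break_sum[OF j(1)] slope_pos[OF j(1)] j(2) by simp
  also have "(\<Sum>k\<in>{1..K} - {..<j}. trunc k t) \<le> 2 * f t"
  proof (cases "j \<le> K")
    case True
    have eq: "{1..K} - {..<j} = {j..K}" using pieces_ge_1[OF j(1)] by auto
    have "(\<Sum>k\<in>{j..K}. trunc k t) \<le> (\<Sum>k\<in>{j..K}. \<alpha> k * t)"
      using high by (intro sum_mono)
    also have "\<dots> = (\<Sum>k\<in>{j..K}. \<alpha> k) * t" by (simp add: sum_distrib_right)
    also have "\<dots> \<le> 2 * \<alpha> j * t"
      using sum_slopes_le[OF j(1) K True] slope_pos[OF K] t by (intro mult_right_mono) auto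
    also have "\<dots> \<le> 2 * f t" using slope_mult_le[OF j] by simp
    finally show ?thesis by (simp only: eq)
  next
    case False
    then have "{1..K} - {..<j} = {}" by auto
    moreover have "0 \<le> f t" using slope_mult_le[OF j] slope_pos[OF j(1)] t
      by (meson less_imp_le mult_nonneg_nonneg order_trans)
    ultimately show ?thesis by (simp only: sum.empty)
  qed
  finally show ?thesis by simp
qed

end

section \<open>Runs of the algorithm\<close>

definition lower :: "sla_state \<Rightarrow> nat \<Rightarrow> nat set" where
  "lower s k = {r. \<exists>j\<in>{1..<k}. status s r = At j}"

lemma lower_match:
  "r \<noteq> r' \<Longrightarrow> status s r = At k \<Longrightarrow> status s r' = At k \<Longrightarrow>
   lower (s\<lparr>status := (status s)(r := Matched r' t, r' := Matched r t)\<rparr>) j =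
     (if 1 \<le> k \<and> k < j then lower s j - {r, r'} else lower s j)"
  by (auto simp: lower_def)

text \<open>Both requests sit at the same counter, so both or neither disappear from below
  \<open>j\<close>.\<close>

lemma even_lower_match:
  assumes "finite (lower s j)" "r \<noteq> r'" "status s r = At k" "status s r' = At k"
  shows "even (card (lower (s\<lparr>status := (status s)(r := Matched r' t, r' := Matched r t)\<rparr>) j))
     \<longleftrightarrow> even (card (lower s j))"
proof (cases "1 \<le> k \<and> k < j")
  case True
  then have sub: "{r, r'} \<subseteq> lower s j" using assms by (auto simp: lower_def)
  then have "card (lower s j - {r, r'}) = card (lower s j) - 2" "2 \<le> card (lower s j)"
    using assms card_mono[OF assms(1) sub] by (simp_all add: card_Diff_subset)
  then show ?thesis using assms True by (simp add: lower_match)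
qed (use assms in \<open>auto simp: lower_match\<close>)

text \<open>A request that climbs from \<open>k\<close> to \<open>Suc k\<close> stays below all
  counters above \<open>Suc k\<close>, and was never below \<open>k\<close>.\<close>

lemma lower_move:
  "status s r = At k \<Longrightarrow> 1 \<le> k \<Longrightarrow>
   lower (s\<lparr>status := (status s)(r := At (Suc k)), counter := c\<rparr>) j =
     (if j = Suc k then lower s j - {r} else lower s j)"
  by (auto simp: lower_def)

lemma lower_arrive:
  "status s r = Pending \<Longrightarrow>
   lower (s\<lparr>status := (status s)(r := At 1)\<rparr>) j = (if 1 < j then insert r (lower s j) else lower s j)"
  by (auto simp: lower_def)

lemma lower_elapse: "lower (s\<lparr>now := t, counter := c\<rparr>) j = lower s j"
  by (simp add: lower_def)

lemma lower_Suc: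
  assumes "\<not> match_due s" "status s r = At k" "1 \<le> k"
  shows "lower s (Suc k) = insert r (lower s k)" "r \<notin> lower s k"
proof -
  have uniq: "r' = r" if "status s r' = At k" for r'
    using assms(1,2) that unfolding match_due_def by metis
  show "lower s (Suc k) = insert r (lower s k)" "r \<notin> lower s k"
    using assms(2,3) by (auto simp: lower_def less_Suc_eq dest: uniq)
qed

lemma lower_Suc_empty:
  assumes "\<nexists>r. status s r = At k"
  shows "lower s (Suc k) = lower s k"
  using assms by (auto simp: lower_def less_Suc_eq)

lemma active_iff: "active s k \<longleftrightarrow> (\<exists>r. status s r = At k) \<and> even (card (lower s k))"
  by (simp add: active_def lower_def)

section \<open>Invariants of the runs\<close>

locale sla = pwl +
  fixes n :: nat and a :: "nat \<Rightarrow> real"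
  assumes inst: "mpmd_instance n a"
begin

abbreviation step :: "sla_state \<Rightarrow> sla_state \<Rightarrow> bool" where
  "step \<equiv> sla_step x \<alpha> n a"

text \<open>Indices from \<open>n\<close> on are no requests and stay \<open>Pending\<close>. The
  symmetry in the last clause makes the matched requests even in number and turns a final state into
  a solution.\<close>

definition valid :: "sla_state \<Rightarrow> bool" where
  "valid s \<longleftrightarrow>
     (\<forall>r. n \<le> r \<longrightarrow> status s r = Pending) \<and>
     (\<forall>r k. status s r = At k \<longrightarrow> k \<in> pieces d \<and> a r \<le> now s) \<and>
     (\<forall>r<n. status s r = Pending \<longrightarrow> now s \<le> a r) \<and>
     (\<forall>r r' t. status s r = Matched r' t \<longrightarrow>
        r' \<noteq> r \<and> status s r' = Matched r t \<and> a r \<le> t \<and> t \<le> now s)"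

text \<open>
  A counter may be full without having a request; when the next request reaches it, the last
  condition ensures that the number of requests below it is even, as it is whenever a counter
  gets full by being active.
\<close>

definition counters_valid :: "sla_state \<Rightarrow> bool" where
  "counters_valid s \<longleftrightarrow>
     (\<forall>k. 0 \<le> counter s k) \<and>
     (\<forall>k\<in>pieces d. ereal (counter s k) \<le> capacity x \<alpha> k) \<and>
     (\<forall>k\<in>pieces d. (\<exists>r. status s r = At k) \<or> 0 < counter s k \<longrightarrow>
        X (k - 1) + counter s k / \<alpha> k \<le> now s) \<and>
     (\<forall>k\<in>pieces d. ereal (counter s k) = capacity x \<alpha> k \<longrightarrow>
        odd (card (lower s k)) \<longrightarrow> odd (card (lower s (Suc k))))"

lemma validD:
  assumes "valid s"
  shows "n \<le> r \<Longrightarrow> status s r = Pending"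
    and "status s r = At k \<Longrightarrow> k \<in> pieces d \<and> a r \<le> now s"
    and "r < n \<Longrightarrow> status s r = Pending \<Longrightarrow> now s \<le> a r"
    and "status s r = Matched r' t \<Longrightarrow> r' \<noteq> r \<and> status s r' = Matched r t \<and> a r \<le> t \<and> t \<le> now s"
  using assms unfolding valid_def by blast+

lemma counters_validD:
  assumes "counters_valid s"
  shows "0 \<le> counter s k"
    and "k \<in> pieces d \<Longrightarrow> ereal (counter s k) \<le> capacity x \<alpha> k"
    and "k \<in> pieces d \<Longrightarrow> (\<exists>r. status s r = At k) \<or> 0 < counter s k \<Longrightarrow>
           X (k - 1) + counter s k / \<alpha> k \<le> now s"
    and "k \<in> pieces d \<Longrightarrow> ereal (counter s k) = capacity x \<alpha> k \<Longrightarrow>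
           odd (card (lower s k)) \<Longrightarrow> odd (card (lower s (Suc k)))"
  using assms unfolding counters_valid_def by blast+

lemma finite_lower: "valid s \<Longrightarrow> finite (lower s k)"
  by (rule finite_subset[of _ "{..<n}"]) (auto simp: lower_def not_le[symmetric] dest: validD(1))

lemma valid_init: "valid sla_init"
  using inst by (simp add: valid_def sla_init_def mpmd_instance_def)

lemma counters_valid_init: "counters_valid sla_init"
proof -
  have "0 \<le> capacity x \<alpha> k" if "k \<in> pieces d" for k
    using capacity_pos[OF that] by simp
  then show ?thesis by (simp add: counters_valid_def sla_init_def lower_def zero_ereal_def[symmetric])
qed

text \<open>Shared by moves, arrivals and elapsing time, which leave the matched requests as they
  are.\<close>

lemma valid_step_unmatched:
  assumes "valid s" "now s \<le> now s'"
    and "\<And>r r' t. status s' r = Matched r' t \<longleftrightarrow> status s r = Matched r' t"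
    and "\<And>r. n \<le> r \<Longrightarrow> status s' r = Pending"
    and "\<And>r k. status s' r = At k \<Longrightarrow> k \<in> pieces d \<and> a r \<le> now s'"
    and "\<And>r. r < n \<Longrightarrow> status s' r = Pending \<Longrightarrow> now s' \<le> a r"
  shows "valid s'"
proof -
  have "r' \<noteq> r \<and> status s' r' = Matched r t \<and> a r \<le> t \<and> t \<le> now s'"
    if "status s' r = Matched r' t" for r r' t
    using validD(4)[OF assms(1), of r r' t] that assms(2) unfolding assms(3) by linarith
  with assms(4-6) show ?thesis unfolding valid_def by blast
qed

lemma valid_step:
  assumes "step s s'" and v: "valid s"
  shows "valid s'"
  using assms(1)
proof cases
  case (match r r' k)
  have m: "q' \<noteq> q \<and> status s' q' = Matched q t \<and> a q \<le> t \<and> t \<le> now s'"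
    if "status s' q = Matched q' t" for q q' t
  proof (cases "q = r \<or> q = r'")
    case True
    then show ?thesis using that match(2) validD(2)[OF v match(3)] validD(2)[OF v match(4)]
      by (auto simp: match(1) split: if_splits)
  next
    case False
    then have "status s q = Matched q' t" using that by (simp add: match(1))
    \<comment> \<open>The partner of an older matched request is itself matched, hence neither of
      the two requests matched now.\<close>
    moreover from validD(4)[OF v this] have "q' \<noteq> r" "q' \<noteq> r'"
      using match(3,4) by auto
    ultimately show ?thesis using validD(4)[OF v, of q q' t] by (simp add: match(1))
  qed
  have "r < n" "r' < n"
    using validD(1)[OF v] match(3,4) by (metis not_le status.distinct(1))+
  then have "status s' q = Pending \<longleftrightarrow> status s q = Pending" "status s' q = At j \<Longrightarrow> status s q = At j" for q j
    using match(3,4) by (auto simp: match(1) split: if_splits)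
  note st = this
  have "now s' = now s" by (simp add: match(1))
  then have "status s' q = At j \<Longrightarrow> j \<in> pieces d \<and> a q \<le> now s'"
    "q < n \<Longrightarrow> status s' q = Pending \<Longrightarrow> now s' \<le> a q" "n \<le> q \<Longrightarrow> status s' q = Pending" for q j
    using validD(1,3)[OF v, of q] validD(2)[OF v st(2)[of q j]] st(1)[of q] by auto
  then show ?thesis using m unfolding valid_def by blast
next
  case (move r k)
  have k: "k \<in> pieces d" using validD(2)[OF v move(3)] by simp
  have "capacity x \<alpha> k \<noteq> \<infinity>" using move(4) by (metis PInfty_neq_ereal(1))
  then have "Suc k \<in> pieces d" using Suc_pieces[OF k] by simp
  moreover have "r < n" using validD(1)[OF v] move(3) by (metis not_le status.distinct(1))
  ultimately show ?thesis
    using validD(1-3)[OF v] move(3)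
    by (intro valid_step_unmatched[OF v]) (auto simp: move(1) split: if_splits)
next
  case (arrive r)
  then show ?thesis
    using validD(1-3)[OF v] pieces_1
    by (intro valid_step_unmatched[OF v]) (auto simp: arrive(1) split: if_splits)
next
  case (elapse \<delta>)
  have "a r \<le> now s + \<delta>" if "status s r = At k" for r k
    using validD(2)[OF v that] elapse(4) by simp
  then show ?thesis
    using validD(1,2)[OF v] elapse(4,5)
    by (intro valid_step_unmatched[OF v]) (auto simp: elapse(1))
qed

text \<open>If the number of requests below \<open>k\<close> were odd, the parity clause of
  \<open>counters_valid\<close> would make the number up to \<open>k\<close> odd too, although it is
  larger by one. The time bound holds because a full counter has
  \<open>counter s k / \<alpha> k = X k - X (k - 1)\<close>.\<close>

lemma move_facts:
  assumes v: "valid s" and c: "counters_valid s"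
    and m: "\<not> match_due s" "status s r = At k" "ereal (counter s k) = capacity x \<alpha> k"
  shows "k \<in> pieces d" "Suc k \<in> pieces d" "counter s k = y k" "even (card (lower s k))"
    "odd (card (lower s (Suc k)))" "X k \<le> now s"
proof -
  show k: "k \<in> pieces d" using validD(2)[OF v m(2)] by simp
  have "capacity x \<alpha> k \<noteq> \<infinity>" using m(3) by (metis PInfty_neq_ereal(1))
  then show Sk: "Suc k \<in> pieces d" using Suc_pieces[OF k] by simp
  show ck: "counter s k = y k" using m(3) by (metis real_of_ereal.simps(1))
  note low = lower_Suc[OF m(1,2) pieces_ge_1[OF k]]
  have "card (lower s (Suc k)) = Suc (card (lower s k))"
    using low finite_lower[OF v, of k] by simp
  with counters_validD(4)[OF c k m(3)]
  show "even (card (lower s k))" "odd (card (lower s (Suc k)))" by auto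
  have "counter s k / \<alpha> k = X k - X (k - 1)"
    using y_eq[OF k break_not_infinite[OF Sk]] slope_pos[OF k] ck by simp
  then show "X k \<le> now s" using counters_validD(3)[OF c k] m(2) by fastforce
qed

text \<open>By the time clause, counter \<open>k\<close> is not in use before time
  \<open>X (k - 1)\<close>. This survives because a counter grows at most at its slope, and a move
  out of \<open>k\<close> happens at time \<open>X k\<close> at the earliest.\<close>

lemma counters_valid_step:
  assumes st: "step s s'" and v: "valid s" and c: "counters_valid s"
  shows "counters_valid s'"
  using st
proof cases
  case (match r r' k)
  have "odd (card (lower s' j)) \<longleftrightarrow> odd (card (lower s j))" for j
    unfolding match(1) using even_lower_match[OF finite_lower[OF v] match(2-4)] by simp
  moreover have "status s q = At j" if "status s' q = At j" for q j
    using that by (auto simp: match(1) split: if_splits)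
  moreover have "counter s' = counter s" "now s' = now s" by (simp_all add: match(1))
  ultimately show ?thesis
    using counters_validD[OF c] unfolding counters_valid_def by metis
next
  case (move r k)
  note facts = move_facts[OF v c move(2-4)]
  have k1: "1 \<le> k" using pieces_ge_1 facts(1) .
  note low = lower_move[OF move(3) k1]
  have ev: "even (card (lower s' (Suc k)))"
    using lower_Suc[OF move(2,3) k1] facts(4) unfolding move(1) low by simp
  have used: "X (j - 1) + counter s' j / \<alpha> j \<le> now s'"
    if j: "j \<in> pieces d" "(\<exists>r. status s' r = At j) \<or> 0 < counter s' j" for j
  proof (cases "j = k")
    case True
    have "status s' q \<noteq> At k" for q
      using move(2,3) by (auto simp: move(1) match_due_def)
    with True j(2) show ?thesis by (simp add: move(1))
  next
    case False
    then have cj: "counter s' j = counter s j" by (simp add: move(1))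
    show ?thesis
    proof (cases "j = Suc k \<and> counter s j = 0")
      case True
      then show ?thesis using facts(6) by (auto simp: move(1))
    next
      case f: False
      have "(\<exists>r. status s r = At j) \<or> 0 < counter s j"
      proof (cases "j = Suc k")
        case True
        then have "counter s j \<noteq> 0" using f by simp
        then show ?thesis using counters_validD(1)[OF c, of j] by linarith
      next
        case False
        then have "status s q = At j" if "status s' q = At j" for q
          using that by (simp add: move(1) split: if_splits)
        then show ?thesis using j(2) unfolding cj by blast
      qed
      then show ?thesis using counters_validD(3)[OF c j(1)] cj by (simp add: move(1))
    qed
  qed
  have nz: "ereal 0 < capacity x \<alpha> k" using capacity_pos[OF facts(1)] by (simp add: zero_ereal_def)
  \<comment> \<open>Counter \<open>k\<close> is reset and no longer full, an even number of requests
    remains below \<open>Suc k\<close>, and nothing changes for the other counters.\<close>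
  have full: "odd (card (lower s' (Suc j)))"
    if j: "j \<in> pieces d" "ereal (counter s' j) = capacity x \<alpha> j" "odd (card (lower s' j))" for j
  proof -
    have "j \<noteq> k" using j(2) nz by (auto simp: move(1))
    moreover have "j \<noteq> Suc k" using j(3) ev by auto
    ultimately show ?thesis using j counters_validD(4)[OF c j(1)]
      by (simp add: move(1) low)
  qed
  have "0 \<le> counter s' j" for j
    using counters_validD(1)[OF c] by (simp add: move(1))
  moreover have "ereal (counter s' j) \<le> capacity x \<alpha> j" if "j \<in> pieces d" for j
    using counters_validD(2)[OF c that] less_imp_le[OF nz] by (simp add: move(1))
  ultimately show ?thesis using used full unfolding counters_valid_def by blast
next
  case (arrive r)
  have "0 \<le> now s" using inst arrive by (auto simp: mpmd_instance_def)
  \<comment> \<open>No move is due, so a full counter has no request, and the counts below it and up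
    to it agree.\<close>
  have full: "odd (card (lower s' (Suc j)))"
    if j: "j \<in> pieces d" "ereal (counter s' j) = capacity x \<alpha> j" "odd (card (lower s' j))" for j
  proof -
    have "\<nexists>r. status s r = At j" using j arrive(3) by (auto simp: arrive(1) move_due_def)
    moreover have "j \<noteq> 1" using j(3) by (auto simp: lower_def)
    ultimately have "\<nexists>r. status s' r = At j" by (auto simp: arrive(1))
    then show ?thesis using j(3) by (simp add: lower_Suc_empty)
  qed
  have used: "X (j - 1) + counter s' j / \<alpha> j \<le> now s'"
    if j: "j \<in> pieces d" "(\<exists>r. status s' r = At j) \<or> 0 < counter s' j" for j
  proof (cases "j = 1 \<and> counter s 1 = 0")
    case True
    then show ?thesis using \<open>0 \<le> now s\<close> by (simp add: arrive(1))
  next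
    case False
    then have "(\<exists>r. status s r = At j) \<or> 0 < counter s j"
      using j(2) counters_validD(1)[OF c, of j]
      by (auto simp: arrive(1) less_le split: if_splits)
    then show ?thesis using counters_validD(3)[OF c j(1)] by (simp add: arrive(1))
  qed
  have "counter s' = counter s" by (simp add: arrive(1))
  then show ?thesis
    using used full counters_validD(1,2)[OF c] unfolding counters_valid_def by metis
next
  case (elapse \<delta>)
  have act: "k \<in> pieces d" if "active s k" for k
    using that validD(2)[OF v] by (auto simp: active_iff)
  have used: "X (j - 1) + counter s' j / \<alpha> j \<le> now s'"
    if j: "j \<in> pieces d" "(\<exists>r. status s' r = At j) \<or> 0 < counter s' j" for j
  proof -
    have "(\<exists>r. status s r = At j) \<or> 0 < counter s j"
      using j(2) by (auto simp: elapse(1) active_iff split: if_splits)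
    then have "X (j - 1) + counter s j / \<alpha> j \<le> now s" using counters_validD(3)[OF c j(1)] by simp
    then show ?thesis using elapse(4) slope_pos[OF j(1)] by (simp add: elapse(1) add_divide_distrib)
  qed
  \<comment> \<open>A counter with an odd number of requests below it is inactive, so it was full
    before.\<close>
  have full: "odd (card (lower s' (Suc j)))"
    if j: "j \<in> pieces d" "ereal (counter s' j) = capacity x \<alpha> j" "odd (card (lower s' j))" for j
  proof -
    have "\<not> active s j" using j(3) by (simp add: elapse(1) lower_elapse active_iff)
    then show ?thesis using j counters_validD(4)[OF c j(1)] by (simp add: elapse(1) lower_elapse)
  qed
  have "0 \<le> counter s' j" for j
    using counters_validD(1)[OF c, of j] elapse(4) slope_pos[OF act[of j]]
    by (auto simp: elapse(1) intro!: add_nonneg_nonneg)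
  moreover have "ereal (counter s' j) \<le> capacity x \<alpha> j" if "j \<in> pieces d" for j
    using counters_validD(2)[OF c that] elapse(6) by (simp add: elapse(1))
  ultimately show ?thesis using used full unfolding counters_valid_def by blast
qed

lemma run_valid:
  assumes "step\<^sup>*\<^sup>* s s'" "valid s" "counters_valid s"
  shows "valid s' \<and> counters_valid s'"
  using assms(1)
proof (induction rule: rtranclp_induct)
  case (step t u)
  then show ?case using valid_step[OF step.hyps(2)] counters_valid_step[OF step.hyps(2)] by simp
qed (simp add: assms(2,3))

lemma reachable_valid:
  assumes "sla_reachable x \<alpha> n a s"
  shows "valid s" "counters_valid s"
  using run_valid[OF assms[unfolded sla_reachable_def] valid_init counters_valid_init] by auto

end

section \<open>Termination\<close>

text \<open>The involution splits the set into pairs. It is applied to the matches of the algorithm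
  and to the offline pairs.\<close>

lemma even_card_involution:
  assumes "finite S" "\<And>i. i \<in> S \<Longrightarrow> q i \<in> S \<and> q i \<noteq> i \<and> q (q i) = i"
  shows "even (card S)"
  using assms
proof (induction S rule: finite_psubset_induct)
  case (psubset S)
  show ?case
  proof (cases "S = {}")
    case False
    then obtain i where i: "i \<in> S" by blast
    have q: "q i \<in> S" "q i \<noteq> i" "q (q i) = i" using psubset.prems[OF i] by auto
    have "even (card (S - {i, q i}))"
    proof (rule psubset.IH)
      show "S - {i, q i} \<subset> S" using i by blast
      show "q j \<in> S - {i, q i} \<and> q j \<noteq> j \<and> q (q j) = j" if "j \<in> S - {i, q i}" for j
      proof -
        have "q (q j) = j" using psubset.prems that by blast
        then have "q j \<noteq> i" "q j \<noteq> q i" using that q(3) by auto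
        then show ?thesis using psubset.prems that by blast
      qed
    qed
    moreover have "card S = Suc (Suc (card (S - {i, q i})))"
      using i q psubset.hyps(1) card_Diff_subset[of "{i, q i}" S] card_mono[of S "{i, q i}"]
      by simp
    ultimately show ?thesis by simp
  qed simp
qed

context sla
begin

section \<open>Waiting and live requests, and the next event\<close>

definition waiting :: "(nat \<Rightarrow> status) \<Rightarrow> nat set" where
  "waiting st = {r. r < n \<and> st r = Pending}"

definition live :: "(nat \<Rightarrow> status) \<Rightarrow> nat set" where
  "live st = {r. r < n \<and> (\<exists>k. st r = At k)}"

lemma finite_waiting [simp]: "finite (waiting st)" and finite_live [simp]: "finite (live st)"
  by (simp_all add: waiting_def live_def)

lemma at_less_n: "valid s \<Longrightarrow> status s r = At k \<Longrightarrow> r < n"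
  using validD(1)[of s r] by (cases "r < n") auto

lemma matched_less_n: "valid s \<Longrightarrow> status s r = Matched q t \<Longrightarrow> r < n"
  using validD(1)[of s r] by (cases "r < n") auto

text \<open>The matched requests come in pairs, and \<open>n\<close> is even.\<close>

lemma even_live:
  assumes v: "valid s" and p: "waiting (status s) = {}"
  shows "even (card (live (status s)))"
proof -
  define M where "M = {r. r < n \<and> (\<exists>r' t. status s r = Matched r' t)}"
  define q where "q r = (case status s r of Matched r' t \<Rightarrow> r' | _ \<Rightarrow> r)" for r
  have "even (card M)"
  proof (rule even_card_involution[where q = q])
    fix r assume "r \<in> M"
    then obtain r' t where r: "status s r = Matched r' t" by (auto simp: M_def)
    note r' = validD(4)[OF v r]
    then have "r' < n" using matched_less_n[OF v, of r'] by blast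
    with r r' show "q r \<in> M \<and> q r \<noteq> r \<and> q (q r) = r" by (simp add: q_def M_def)
  qed (simp add: M_def)
  moreover have "{..<n} = M \<union> live (status s)"
  proof -
    have "r \<in> M \<union> live (status s)" if "r < n" for r
      using that p by (cases "status s r") (auto simp: M_def live_def waiting_def)
    then show ?thesis by (auto simp: M_def live_def)
  qed
  moreover have "M \<inter> live (status s) = {}" by (auto simp: M_def live_def)
  ultimately have "n = card M + card (live (status s))"
    by (metis card_Un_disjoint card_lessThan finite_live finite_lessThan finite_Un)
  with \<open>even (card M)\<close> inst show ?thesis by (metis even_add mpmd_instance_def)
qed

lemma lower_subset_live: "valid s \<Longrightarrow> lower s k \<subseteq> live (status s)"
  using at_less_n by (auto simp: lower_def live_def)

lemma ex_event:
  assumes v: "valid s" and c: "counters_valid s"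
    and quiet: "\<not> match_due s" "\<not> move_due x \<alpha> s" "\<not> (\<exists>r<n. status s r = Pending \<and> a r = now s)"
    and unfinished: "waiting (status s) \<union> live (status s) \<noteq> {}"
  obtains s' where "step s s'" "status s' = status s"
    "move_due x \<alpha> s' \<or> (\<exists>r<n. status s' r = Pending \<and> a r = now s')"
proof -
  \<comment> \<open>Active counters of infinite capacity never fill up and set no deadline.\<close>
  define A where "A = {k. active s k \<and> capacity x \<alpha> k \<noteq> \<infinity>}"
  define S where "S = (\<lambda>r. a r - now s) ` waiting (status s) \<union> (\<lambda>k. (y k - counter s k) / \<alpha> k) ` A"
  have A: "k \<in> pieces d" if "active s k" for k
    using that validD(2)[OF v] by (auto simp: active_iff)
  have lt: "ereal (counter s k) < capacity x \<alpha> k" if k: "active s k" for k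
  proof -
    have "ereal (counter s k) \<noteq> capacity x \<alpha> k"
      using k quiet(2) by (auto simp: active_iff move_due_def)
    then show ?thesis using counters_validD(2)[OF c A[OF k]] by simp
  qed
  have "A \<subseteq> (\<lambda>r. case status s r of At k \<Rightarrow> k) ` {..<n}"
  proof
    fix k assume "k \<in> A"
    then obtain r where "status s r = At k" by (auto simp: A_def active_iff)
    then show "k \<in> (\<lambda>r. case status s r of At k \<Rightarrow> k) ` {..<n}"
      using at_less_n[OF v] by (intro image_eqI[of _ _ r]) auto
  qed
  then have "finite A" by (rule finite_subset) simp
  then have fin: "finite S" by (simp add: S_def)
  have pos: "0 < e" if e: "e \<in> S" for e
  proof -
    consider r where "r \<in> waiting (status s)" "e = a r - now s"
      | k where "k \<in> A" "e = (y k - counter s k) / \<alpha> k"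
      using e by (auto simp: S_def)
    then show ?thesis
    proof cases
      case 1
      then have "now s \<le> a r" "a r \<noteq> now s"
        using quiet(3) validD(3)[OF v, of r] unfolding waiting_def by blast+
      then show ?thesis using 1(2) by linarith
    next
      case (2 k)
      then have k: "active s k" "capacity x \<alpha> k \<noteq> \<infinity>" by (auto simp: A_def)
      have "counter s k < y k" using lt[OF k(1)] capacity_iff(1)[OF A[OF k(1)] k(2)] by simp
      then show ?thesis using slope_pos[OF A[OF k(1)]] 2 by simp
    qed
  qed
  \<comment> \<open>Without waiting requests, the lowest occupied counter is active, as nothing is
    below it. The live requests are even in number, so another one sits higher up; hence this
    counter is not the last and its capacity is finite.\<close>
  have "S \<noteq> {}"
  proof (cases "waiting (status s) = {}")
    case True
    then have "live (status s) \<noteq> {}" using unfinished by blast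
    define k where "k = (LEAST k. \<exists>r. status s r = At k)"
    have ex: "\<exists>k r. status s r = At k" using \<open>live (status s) \<noteq> {}\<close> by (auto simp: live_def)
    have k: "\<exists>r. status s r = At k" unfolding k_def using ex by (rule LeastI_ex)
    have min: "k \<le> j" if "status s r = At j" for r j
      unfolding k_def using that by (blast intro: Least_le)
    have "lower s k = {}" using min by (fastforce simp: lower_def)
    then have act: "active s k" using k by (simp add: active_iff)
    obtain r where r: "status s r = At k" using k by blast
    have "live (status s) \<noteq> {r}" using even_live[OF v True] by auto
    moreover have "r \<in> live (status s)" using r at_less_n[OF v r] by (simp add: live_def)
    ultimately obtain r' where r': "r' \<in> live (status s)" "r' \<noteq> r" by blast
    then obtain j where j: "status s r' = At j" by (auto simp: live_def)
    have "j \<noteq> k" using quiet(1) r j r'(2) by (auto simp: match_due_def)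
    with min[OF j] have "Suc k \<le> j" by simp
    moreover have "j \<in> pieces d" using validD(2)[OF v j] by simp
    ultimately have "Suc k \<in> pieces d" using pieces_down by simp
    then have "k \<in> A" using act capacity_finite[OF _ pieces_ge_1[OF A[OF act]]] by (simp add: A_def)
    then show ?thesis by (auto simp: S_def)
  qed (simp add: S_def)
  define \<delta> where "\<delta> = Min S"
  have \<delta>: "\<delta> \<in> S" "\<And>e. e \<in> S \<Longrightarrow> \<delta> \<le> e"
    unfolding \<delta>_def using fin \<open>S \<noteq> {}\<close> by simp_all
  define s' where "s' = s\<lparr>now := now s + \<delta>,
         counter := (\<lambda>k. if active s k then counter s k + \<alpha> k * \<delta> else counter s k)\<rparr>"
  have "ereal (counter s k + \<alpha> k * \<delta>) \<le> capacity x \<alpha> k" if k: "active s k" for k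
  proof (cases "capacity x \<alpha> k = \<infinity>")
    case False
    then have "\<delta> \<le> (y k - counter s k) / \<alpha> k" using k by (intro \<delta>(2)) (auto simp: S_def A_def)
    then have "counter s k + \<alpha> k * \<delta> \<le> y k" using slope_pos[OF A[OF k]] by (simp add: field_simps)
    then show ?thesis using capacity_iff(2)[OF A[OF k] False] by simp
  qed simp
  moreover have "now s + \<delta> \<le> a r" if "r < n" "status s r = Pending" for r
    using \<delta>(2)[of "a r - now s"] that by (auto simp: S_def waiting_def)
  ultimately have "step s s'"
    unfolding s'_def using pos[OF \<delta>(1)] quiet(1,2) by (intro sla_step.elapse) auto
  moreover have "status s' = status s" by (simp add: s'_def)
  moreover have "move_due x \<alpha> s' \<or> (\<exists>r<n. status s' r = Pending \<and> a r = now s')"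
  proof -
    consider r where "r \<in> waiting (status s)" "\<delta> = a r - now s"
      | k where "k \<in> A" "\<delta> = (y k - counter s k) / \<alpha> k"
      using \<delta>(1) by (auto simp: S_def)
    then show ?thesis
    proof cases
      case 1
      then show ?thesis by (auto simp: s'_def waiting_def)
    next
      case (2 k)
      then have k: "active s k" "capacity x \<alpha> k \<noteq> \<infinity>" by (auto simp: A_def)
      have "counter s' k = y k"
        using k(1) slope_pos[OF A[OF k(1)]] unfolding s'_def 2(2) by simp
      then have "ereal (counter s' k) = capacity x \<alpha> k"
        using capacity_iff(3)[OF A[OF k(1)] k(2)] by simp
      moreover obtain r where "status s' r = At k" using k(1) by (auto simp: active_iff s'_def)
      ultimately show ?thesis unfolding move_due_def by blast
    qed
  qed
  ultimately show thesis using that by blast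
qed

text \<open>An arrival makes a waiting request live and a match removes two live ones, so both lower
  the weight. Moves and elapsing time keep it.\<close>

definition weight :: "(nat \<Rightarrow> status) \<Rightarrow> nat" where
  "weight st = 2 * card (waiting st) + card (live st)"

lemma weight_match:
  assumes "valid s" "r \<noteq> r'" "status s r = At k" "status s r' = At k"
  shows "weight ((status s)(r := Matched r' t, r' := Matched r t)) < weight (status s)"
proof -
  have n: "r < n" "r' < n" using at_less_n assms by blast+
  have "waiting ((status s)(r := Matched r' t, r' := Matched r t)) = waiting (status s)"
    using assms by (auto simp: waiting_def)
  moreover have "live ((status s)(r := Matched r' t, r' := Matched r t)) \<subset> live (status s)"
    using assms n by (auto simp: live_def)
  ultimately show ?thesis by (simp add: weight_def psubset_card_mono)
qed

lemma weight_arrive: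
  assumes "r < n" "status s r = Pending"
  shows "weight ((status s)(r := At 1)) < weight (status s)"
proof -
  have "waiting ((status s)(r := At 1)) = waiting (status s) - {r}" "r \<in> waiting (status s)"
    using assms by (auto simp: waiting_def)
  moreover have "live ((status s)(r := At 1)) = insert r (live (status s))" "r \<notin> live (status s)"
    using assms by (auto simp: live_def)
  ultimately show ?thesis
    using card_gt_0_iff[of "waiting (status s)"] by (auto simp: weight_def)
qed

section \<open>Climbing of the requests while the weight is constant\<close>

lemma waiting_live_move:
  assumes "r < n" "status s r = At k"
  shows "waiting ((status s)(r := At j)) = waiting (status s)"
    "live ((status s)(r := At j)) = live (status s)"
  using assms by (auto simp: waiting_def live_def)

definition climb :: "nat \<Rightarrow> (nat \<Rightarrow> status) \<Rightarrow> nat" where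
  "climb L st = (\<Sum>r<n. case st r of At k \<Rightarrow> L - k | _ \<Rightarrow> 0)"

lemma climb_move:
  assumes "r < n" "status s r = At k" "Suc k \<le> L"
  shows "climb L ((status s)(r := At (Suc k))) < climb L (status s)"
  unfolding climb_def
proof (rule sum_strict_mono_ex1)
  show "\<exists>q\<in>{..<n}. (case ((status s)(r := At (Suc k))) q of At k \<Rightarrow> L - k | _ \<Rightarrow> 0)
      < (case status s q of At k \<Rightarrow> L - k | _ \<Rightarrow> 0)"
    using assms by (intro bexI[of _ r]) auto
qed (use assms in auto)

text \<open>Stable under moves. The second clause bounds the levels reachable before the next
  arrival, as time cannot pass the arrival of any waiting request; with none waiting, parity takes
  over this role.\<close>

definition level_bound :: "nat \<Rightarrow> (nat \<Rightarrow> status) \<Rightarrow> bool" where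
  "level_bound L st \<longleftrightarrow> (\<forall>r k. st r = At k \<longrightarrow> k \<le> L) \<and>
     (waiting st \<noteq> {} \<longrightarrow> (\<exists>r\<in>waiting st. \<forall>k\<in>pieces d. X (k - 1) \<le> a r \<longrightarrow> k \<le> L))"

lemma ex_level_bound:
  assumes v: "valid s" and c: "counters_valid s"
  obtains L where "level_bound L (status s)"
proof (cases "waiting (status s) = {}")
  case True
  let ?f = "\<lambda>r. case status s r of At k \<Rightarrow> k | _ \<Rightarrow> 0"
  have "k \<le> Max (?f ` {..<n})" if "status s r = At k" for r k
  proof -
    have "k \<in> ?f ` {..<n}" using that at_less_n[OF v that] by (intro image_eqI[of _ _ r]) auto
    then show ?thesis by (intro Max_ge) auto
  qed
  with True that show thesis by (auto simp: level_bound_def)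
next
  case False
  then obtain r where r: "r \<in> waiting (status s)" by blast
  then have ar: "now s \<le> a r" "0 \<le> a r"
    using validD(3)[OF v] inst by (auto simp: waiting_def mpmd_instance_def)
  obtain L where L: "\<And>k. k \<in> pieces d \<Longrightarrow> X (k - 1) \<le> a r \<Longrightarrow> k \<le> L"
    using levels_bounded[OF ar(2)] by metis
  have "k \<le> L" if "status s q = At k" for q k
  proof (rule L)
    show k: "k \<in> pieces d" using validD(2)[OF v that] by simp
    have "0 \<le> counter s k / \<alpha> k" using counters_validD(1)[OF c] slope_pos[OF k] by simp
    moreover have "X (k - 1) + counter s k / \<alpha> k \<le> now s" using counters_validD(3)[OF c k] that by blast
    ultimately show "X (k - 1) \<le> a r" using ar(1) by linarith
  qed
  with r L that show thesis unfolding level_bound_def by blast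
qed

text \<open>If a request is waiting, \<open>X k \<le> now s\<close> puts level \<open>Suc k\<close>
  within the bound. If none is, the live requests are even in number but those up to
  \<open>k\<close> odd, so another one already sits at \<open>Suc k\<close> or higher.\<close>

lemma level_bound_move:
  assumes v: "valid s" and c: "counters_valid s"
    and m: "\<not> match_due s" "status s r = At k" "ereal (counter s k) = capacity x \<alpha> k"
    and b: "level_bound L (status s)"
  shows "Suc k \<le> L" "level_bound L ((status s)(r := At (Suc k)))"
proof -
  note facts = move_facts[OF v c m]
  show S: "Suc k \<le> L"
  proof (cases "waiting (status s) = {}")
    case True
    have "lower s (Suc k) \<noteq> live (status s)" using even_live[OF v True] facts(5) by auto
    then obtain q where q: "q \<in> live (status s)" "q \<notin> lower s (Suc k)"
      using lower_subset_live[OF v] by blast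
    then obtain j where j: "status s q = At j" by (auto simp: live_def)
    have "1 \<le> j" using validD(2)[OF v j] pieces_ge_1 by blast
    then have "Suc k \<le> j" using q(2) j by (fastforce simp: lower_def)
    moreover have "j \<le> L" using b j by (simp add: level_bound_def)
    ultimately show ?thesis by simp
  next
    case False
    then obtain q where q: "q \<in> waiting (status s)" "\<forall>k\<in>pieces d. X (k - 1) \<le> a q \<longrightarrow> k \<le> L"
      using b by (auto simp: level_bound_def)
    have "now s \<le> a q" using q(1) validD(3)[OF v] by (simp add: waiting_def)
    then have "X (Suc k - 1) \<le> a q" using facts(6) by simp
    then show ?thesis using q(2) facts(2) by blast
  qed
  have "waiting ((status s)(r := At (Suc k))) = waiting (status s)"
    using waiting_live_move(1)[OF at_less_n[OF v m(2)] m(2)] .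
  moreover have "j \<le> L" if "((status s)(r := At (Suc k))) q = At j" for q j
    using that S b by (auto simp: level_bound_def split: if_splits)
  ultimately show "level_bound L ((status s)(r := At (Suc k)))"
    using b unfolding level_bound_def by metis
qed

lemma completes:
  assumes "valid s" "counters_valid s"
  shows "\<exists>s' p m. step\<^sup>*\<^sup>* s s' \<and> sla_result n s' p m"
  using assms
proof (induction "weight (status s)" arbitrary: s rule: less_induct)
  case less
  note outer = less.hyps
  obtain L where L: "level_bound L (status s)" using ex_level_bound[OF less.prems] .
  \<comment> \<open>Matches and arrivals lower the weight; moves keep it and are handled by an inner
    induction on \<open>climb L\<close> with \<open>L\<close> fixed.\<close>
  have "\<exists>s' p m. step\<^sup>*\<^sup>* t s' \<and> sla_result n s' p m"
    if "valid t" "counters_valid t" "level_bound L (status t)" "weight (status t) = weight (status s)"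
    for t using that
  proof (induction "climb L (status t)" arbitrary: t rule: less_induct)
    case (less t)
    note v = less.prems(1) and c = less.prems(2) and b = less.prems(3) and w = less.prems(4)
    show ?case
    proof (cases "waiting (status t) \<union> live (status t) = {}")
      case True
      have "\<exists>q u. status t r = Matched q u" if "r < n" for r
        using that True by (cases "status t r") (auto simp: waiting_def live_def)
      then have "\<exists>p m. sla_result n t p m" unfolding sla_result_def by metis
      then show ?thesis by blast
    next
      case False
      \<comment> \<open>Elapsing time changes no status, hence neither measure, and is joined with
        the event that follows it.\<close>
      obtain s1 where s1: "step\<^sup>*\<^sup>* t s1" "status s1 = status t"
        "match_due s1 \<or> move_due x \<alpha> s1 \<or> (\<exists>r<n. status s1 r = Pending \<and> a r = now s1)"
      proof (cases "match_due t \<or> move_due x \<alpha> t \<or> (\<exists>r<n. status t r = Pending \<and> a r = now t)")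
        case True
        then show ?thesis using that by blast
      next
        case quiet: False
        then show ?thesis using ex_event[OF v c _ _ _ False] that by (metis r_into_rtranclp)
      qed
      have v1: "valid s1" "counters_valid s1" using run_valid[OF s1(1) v c] by auto
      have "\<exists>s2. step s1 s2 \<and> (\<exists>s' p m. step\<^sup>*\<^sup>* s2 s' \<and> sla_result n s' p m)"
      proof (cases "match_due s1")
        case True
        then obtain k r r' where m: "r \<noteq> r'" "status s1 r = At k" "status s1 r' = At k"
          by (auto simp: match_due_def)
        define s2 where
          "s2 = s1\<lparr>status := (status s1)(r := Matched r' (now s1), r' := Matched r (now s1))\<rparr>"
        have st: "step s1 s2" unfolding s2_def using m by (rule sla_step.match)
        have "weight (status s2) < weight (status s)"
          using weight_match[OF v1(1) m] w by (simp add: s2_def s1(2))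
        then show ?thesis
          using outer[of s2] st valid_step[OF st v1(1)] counters_valid_step[OF st v1] by blast
      next
        case nm: False
        show ?thesis
        proof (cases "move_due x \<alpha> s1")
          case True
          then obtain k r where m: "status s1 r = At k" "ereal (counter s1 k) = capacity x \<alpha> k"
            by (auto simp: move_due_def)
          define s2 where
            "s2 = s1\<lparr>status := (status s1)(r := At (Suc k)), counter := (counter s1)(k := 0)\<rparr>"
          have st: "step s1 s2" unfolding s2_def using nm m by (rule sla_step.move)
          have r: "r < n" using at_less_n[OF v1(1) m(1)] .
          note bm = level_bound_move[OF v1 nm m b[folded s1(2)]]
          have st2: "status s2 = (status s1)(r := At (Suc k))" by (simp add: s2_def)
          have "climb L (status s2) < climb L (status t)"
            using climb_move[OF r m(1) bm(1)] unfolding st2 s1(2) .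
          then have "\<exists>s' p m. step\<^sup>*\<^sup>* s2 s' \<and> sla_result n s' p m"
          proof (rule less.hyps)
            show "valid s2" "counters_valid s2"
              using valid_step[OF st v1(1)] counters_valid_step[OF st v1] .
            show "level_bound L (status s2)" unfolding st2 by (rule bm(2))
            show "weight (status s2) = weight (status s)"
              using waiting_live_move[OF r m(1)] w unfolding st2 by (simp add: weight_def s1(2))
          qed
          with st show ?thesis by blast
        next
          case False
          with nm s1(3) obtain r where r: "r < n" "status s1 r = Pending" "a r = now s1" by blast
          define s2 where "s2 = s1\<lparr>status := (status s1)(r := At 1)\<rparr>"
          have st: "step s1 s2" unfolding s2_def using nm False r by (rule sla_step.arrive)
          have "weight (status s2) < weight (status s)"
            using weight_arrive[OF r(1,2)] w by (simp add: s2_def s1(2))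
          then show ?thesis
            using outer[of s2] st valid_step[OF st v1(1)] counters_valid_step[OF st v1] by blast
        qed
      qed
      then show ?thesis using s1(1) by (meson converse_rtranclp_into_rtranclp rtranclp_trans)
    qed
  qed
  then show ?case using less.prems L by blast
qed

lemma sla_completes: "sla_completes x \<alpha> n a"
  unfolding sla_completes_def using reachable_valid completes by blast

lemma result_solution:
  assumes v: "valid s" and r: "sla_result n s p m"
  shows "solution n a p m"
  unfolding solution_def
proof (intro allI impI)
  fix r assume "r < n"
  then have st: "status s r = Matched (p r) (m r)" using r by (simp add: sla_result_def)
  note pr = validD(4)[OF v st]
  then have "p r < n" using matched_less_n[OF v, of "p r"] by blast
  then have "status s (p r) = Matched (p (p r)) (m (p r))" using r by (simp add: sla_result_def)
  with pr \<open>p r < n\<close> show "p r < n \<and> p r \<noteq> r \<and> p (p r) = r \<and> m (p r) = m r \<and> a r \<le> m r" by simp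
qed

end

section \<open>Competitiveness\<close>

text \<open>The expression is the length of the part before time \<open>t\<close> of the interval
  between \<open>b\<close> and \<open>c\<close>.\<close>

lemma overlap_mono:
  fixes t t' b c :: real
  assumes "t \<le> t'"
  shows "\<bar>min t b - min t c\<bar> \<le> \<bar>min t' b - min t' c\<bar>"
  using assms by (auto simp: min_def abs_if)

lemma overlap_le: "\<bar>min t b - min t c\<bar> \<le> \<bar>b - c\<bar>" for t b c :: real
  by (auto simp: min_def abs_if)

text \<open>A competing offline solution \<open>q\<close>, \<open>\<mu>\<close> and a time horizon
  \<open>T\<close>; \<open>K\<close> covers the counters that can be in use up to
  \<open>T\<close>.\<close>

locale offline = sla +
  fixes q :: "nat \<Rightarrow> nat" and \<mu> :: "nat \<Rightarrow> real" and T :: real and K :: nat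
  assumes sol: "solution n a q \<mu>"
    and K: "K \<in> pieces d" and K_bound: "\<And>k. k \<in> pieces d \<Longrightarrow> X (k - 1) \<le> T \<Longrightarrow> k \<le> K"
begin

section \<open>Long and short offline pairs\<close>

definition gap :: "nat \<Rightarrow> real" where
  "gap r = \<bar>a r - a (q r)\<bar>"

text \<open>The two requests of an offline pair are both long or both short. At infinite capacity
  all are short.\<close>

definition long :: "nat \<Rightarrow> nat set" where
  "long k = {r. r < n \<and> capacity x \<alpha> k \<noteq> \<infinity> \<and> y k \<le> \<alpha> k * gap r}"

definition short :: "nat \<Rightarrow> nat set" where
  "short k = {..<n} - long k"

definition arrived :: "sla_state \<Rightarrow> nat set" where
  "arrived s = {r. status s r \<noteq> Pending}"

definition overlap :: "real \<Rightarrow> nat \<Rightarrow> real" where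
  "overlap t r = \<bar>min t (a r) - min t (a (q r))\<bar>"

text \<open>
  Counter \<open>k\<close> runs only when the number of requests in counters \<open>1, \<dots>, k\<close> is odd. As long as
  \<open>flipped s k\<close> is false, the offline solution then has an open short pair and pays as well.
\<close>

definition flipped :: "sla_state \<Rightarrow> nat \<Rightarrow> bool" where
  "flipped s k \<longleftrightarrow> (odd (card (lower s (Suc k))) \<longleftrightarrow> even (card (short k \<inter> arrived s)))"

text \<open>A running counter lowers the slack while unflipped and raises it while flipped: what the
  offline solution overpays in the former periods is saved for the latter.\<close>

definition slack :: "sla_state \<Rightarrow> nat \<Rightarrow> real" where
  "slack s k = (if flipped s k then counter s k - y k else - counter s k)"

text \<open>Bounds the total increase of counter \<open>k\<close> so far by the offline cost so far.\<close>

definition budget :: "sla_state \<Rightarrow> nat \<Rightarrow> real" where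
  "budget s k = \<alpha> k * (\<Sum>r\<in>short k. overlap (now s) r) + y k * card (long k \<inter> arrived s) + slack s k"

text \<open>For a live request this is the bound of \<open>f_tangent\<close> on its cost if it were
  matched now.\<close>

definition accrued :: "sla_state \<Rightarrow> nat \<Rightarrow> real" where
  "accrued s r = (case status s r of Pending \<Rightarrow> 0
     | At k \<Rightarrow> (\<Sum>i\<in>{1..<k}. y i) + \<alpha> k * (now s - a r)
     | Matched r' t \<Rightarrow> f (t - a r))"

section \<open>Effect of each step on the budget\<close>

lemma partner: "r < n \<Longrightarrow> q r < n \<and> q r \<noteq> r \<and> q (q r) = r"
  and wait_nonneg: "r < n \<Longrightarrow> a r \<le> \<mu> r" and partner_time: "r < n \<Longrightarrow> \<mu> (q r) = \<mu> r"
  using sol by (auto simp: solution_def)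

lemma partner_short: "r \<in> short k \<Longrightarrow> q r \<in> short k"
  using partner by (auto simp: short_def long_def gap_def abs_minus_commute)

lemma finite_sets [simp]: "finite (short k)" "finite (long k)"
  by (auto simp: short_def long_def)

lemma arrived_le_now:
  assumes v: "valid s" and r: "r \<in> arrived s"
  shows "a r \<le> now s"
proof (cases "status s r")
  case (At k)
  then show ?thesis using validD(2)[OF v At] by simp
next
  case (Matched r' t)
  then show ?thesis using validD(4)[OF v Matched] by simp
qed (use r in \<open>simp add: arrived_def\<close>)

text \<open>Otherwise the arrived short requests would split into offline pairs.\<close>

lemma half_arrived:
  assumes "odd (card (short k \<inter> arrived s))"
  shows "\<exists>r\<in>short k. r \<in> arrived s \<and> q r \<notin> arrived s"
proof (rule ccontr)
  assume "\<not> ?thesis"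
  then have "even (card (short k \<inter> arrived s))"
    using partner partner_short
    by (intro even_card_involution[where q = q]) (auto simp: short_def)
  with assms show False by simp
qed

lemma budget_match:
  assumes v: "valid s" and m: "r \<noteq> r'" "status s r = At k" "status s r' = At k"
  defines "s' \<equiv> s\<lparr>status := (status s)(r := Matched r' (now s), r' := Matched r (now s))\<rparr>"
  shows "flipped s' j \<longleftrightarrow> flipped s j" "budget s' j = budget s j"
proof -
  have "arrived s' = arrived s" using m by (auto simp: arrived_def s'_def)
  then show "flipped s' j \<longleftrightarrow> flipped s j"
    using even_lower_match[OF finite_lower[OF v] m] by (simp add: flipped_def s'_def)
  with \<open>arrived s' = arrived s\<close> show "budget s' j = budget s j"
    by (simp add: budget_def slack_def s'_def)
qed

text \<open>One request leaves the counters \<open>1, ..., k\<close>, which flips \<open>k\<close>.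
  A full counter has the same slack as an empty one with the opposite flip, namely
  \<open>- y k\<close> or 0.\<close>

lemma budget_move:
  assumes v: "valid s" and c: "counters_valid s"
    and m: "\<not> match_due s" "status s r = At k" "ereal (counter s k) = capacity x \<alpha> k"
  defines "s' \<equiv> s\<lparr>status := (status s)(r := At (Suc k)), counter := (counter s)(k := 0)\<rparr>"
  shows "flipped s' j \<longleftrightarrow> (if j = k then \<not> flipped s j else flipped s j)" "budget s' j = budget s j"
proof -
  note facts = move_facts[OF v c m]
  have k1: "1 \<le> k" using pieces_ge_1 facts(1) .
  have arr: "arrived s' = arrived s" using m by (auto simp: arrived_def s'_def)
  have low: "lower s' (Suc k) = lower s k" "j \<noteq> k \<Longrightarrow> lower s' (Suc j) = lower s (Suc j)"
    using lower_Suc[OF m(1,2) k1] by (auto simp: s'_def lower_move[OF m(2) k1])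
  then show fl: "flipped s' j \<longleftrightarrow> (if j = k then \<not> flipped s j else flipped s j)"
    using facts(4,5) by (auto simp: flipped_def arr)
  have "slack s' j = slack s j"
    using facts(3) unfolding slack_def fl by (auto simp: s'_def)
  then show "budget s' j = budget s j"
    unfolding budget_def arr by (simp add: s'_def)
qed

text \<open>A short request changes both parities, so nothing flips. A long one flips, which needs
  finite capacity; its share \<open>y k\<close> of the budget covers the change of slack between
  values in \<open>[- y k, 0]\<close>.\<close>

lemma budget_arrive:
  assumes v: "valid s" and c: "counters_valid s" and m: "r < n" "status s r = Pending"
    and k: "k \<in> pieces d" and fin: "flipped s k \<longrightarrow> capacity x \<alpha> k \<noteq> \<infinity>"
  defines "s' \<equiv> s\<lparr>status := (status s)(r := At 1)\<rparr>"
  shows "flipped s' k \<longrightarrow> capacity x \<alpha> k \<noteq> \<infinity>" "budget s k \<le> budget s' k"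
proof -
  have arr: "arrived s' = insert r (arrived s)" "r \<notin> arrived s"
    using m by (auto simp: arrived_def s'_def)
  have "r \<notin> lower s (Suc k)" using m by (auto simp: lower_def)
  then have low: "card (lower s' (Suc k)) = Suc (card (lower s (Suc k)))"
    using lower_arrive[OF m(2)] pieces_ge_1[OF k] finite_lower[OF v] by (simp add: s'_def)
  have cn: "counter s' = counter s" "now s' = now s" by (simp_all add: s'_def)
  have "(flipped s' k \<longrightarrow> capacity x \<alpha> k \<noteq> \<infinity>) \<and> budget s k \<le> budget s' k"
  proof (cases "r \<in> short k")
    case True
    then have "r \<notin> long k" by (simp add: short_def)
    then have "long k \<inter> arrived s' = long k \<inter> arrived s" by (auto simp: arr)
    moreover have "short k \<inter> arrived s' = insert r (short k \<inter> arrived s)" using True by (auto simp: arr)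
    then have "card (short k \<inter> arrived s') = Suc (card (short k \<inter> arrived s))"
      using arr(2) by simp
    then have "flipped s' k \<longleftrightarrow> flipped s k" by (auto simp: flipped_def low)
    ultimately show ?thesis using fin by (simp add: budget_def slack_def cn)
  next
    case False
    then have r: "r \<in> long k" using m(1) by (simp add: short_def)
    then have cap: "capacity x \<alpha> k \<noteq> \<infinity>" by (simp add: long_def)
    have "long k \<inter> arrived s' = insert r (long k \<inter> arrived s)" using r by (auto simp: arr)
    then have lo: "card (long k \<inter> arrived s') = Suc (card (long k \<inter> arrived s))"
      using arr(2) by simp
    have "short k \<inter> arrived s' = short k \<inter> arrived s" using False by (auto simp: arr)
    then have fl: "flipped s' k \<longleftrightarrow> \<not> flipped s k" by (simp add: flipped_def low)
    have "0 \<le> counter s k" "counter s k \<le> y k"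
      using counters_validD(1,2)[OF c] k capacity_iff(2)[OF k cap] by auto
    then have "slack s k \<le> y k + slack s' k" by (simp add: slack_def fl cn)
    then have "budget s k \<le> budget s' k" by (simp add: budget_def lo cn algebra_simps)
    with cap show ?thesis by blast
  qed
  then show "flipped s' k \<longrightarrow> capacity x \<alpha> k \<noteq> \<infinity>" "budget s k \<le> budget s' k" by auto
qed

text \<open>A flipped active counter is paid by its slack. For an unflipped one an open short pair
  pays twice the growth: once for the growth itself and once for the fall of the slack.\<close>

lemma budget_elapse:
  assumes v: "valid s" and quiet: "\<not> match_due s" and \<delta>: "0 < \<delta>"
    and next_arrival: "\<forall>r<n. status s r = Pending \<longrightarrow> now s + \<delta> \<le> a r"
    and k: "k \<in> pieces d"
  defines "s' \<equiv> s\<lparr>now := now s + \<delta>,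
         counter := (\<lambda>k. if active s k then counter s k + \<alpha> k * \<delta> else counter s k)\<rparr>"
  shows "flipped s' k \<longleftrightarrow> flipped s k"
    "budget s k + (if active s k then \<alpha> k * \<delta> else 0) \<le> budget s' k"
proof -
  let ?G = "\<lambda>r. overlap (now s') r - overlap (now s) r"
  have arr: "arrived s' = arrived s" by (simp add: arrived_def s'_def)
  show fl: "flipped s' k \<longleftrightarrow> flipped s k" unfolding flipped_def arr by (simp add: s'_def lower_elapse)
  have G0: "0 \<le> ?G r" for r using overlap_mono[of "now s" "now s'"] \<delta> by (simp add: overlap_def s'_def)
  have sum: "budget s' k - budget s k = \<alpha> k * (\<Sum>r\<in>short k. ?G r) + (slack s' k - slack s k)"
    unfolding budget_def arr by (simp add: sum_subtractf algebra_simps)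
  have sumG: "0 \<le> \<alpha> k * (\<Sum>r\<in>short k. ?G r)"
    using slope_pos[OF k] G0 by (intro mult_nonneg_nonneg sum_nonneg) auto
  show "budget s k + (if active s k then \<alpha> k * \<delta> else 0) \<le> budget s' k"
  proof (cases "active s k \<and> \<not> flipped s k")
    case True
    then obtain r0 where r0: "status s r0 = At k" and ev: "even (card (lower s k))"
      by (auto simp: active_iff)
    have "odd (card (lower s (Suc k)))"
      using lower_Suc[OF quiet r0 pieces_ge_1[OF k]] finite_lower[OF v] ev by simp
    then have "odd (card (short k \<inter> arrived s))" using True by (simp add: flipped_def)
    then obtain r where r: "r \<in> short k" "r \<in> arrived s" "q r \<notin> arrived s"
      using half_arrived by blast
    have n: "r < n" using r(1) by (simp add: short_def)
    note pr = partner[OF n]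
    have "a r \<le> now s" using arrived_le_now[OF v r(2)] .
    \<comment> \<open>The partner is still pending, so the whole period counts for both requests of
      the pair.\<close>
    moreover have "now s + \<delta> \<le> a (q r)" using next_arrival pr r(3) by (simp add: arrived_def)
    ultimately have "?G r = \<delta>" "?G (q r) = \<delta>"
      using \<delta> pr by (simp_all add: overlap_def s'_def min_def abs_if)
    then have "2 * \<delta> = (\<Sum>r\<in>{r, q r}. ?G r)" using pr by simp
    also have "\<dots> \<le> (\<Sum>r\<in>short k. ?G r)"
      using r(1) partner_short[OF r(1)] G0 by (intro sum_mono2) auto
    finally have "\<alpha> k * (2 * \<delta>) \<le> \<alpha> k * (\<Sum>r\<in>short k. ?G r)"
      using slope_pos[OF k] by (intro mult_left_mono) auto
    moreover have "slack s' k - slack s k = - \<alpha> k * \<delta>"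
      unfolding slack_def fl using True by (simp add: s'_def)
    ultimately show ?thesis using sum True by simp
  next
    case False
    have "slack s' k - slack s k = (if active s k then \<alpha> k * \<delta> else 0)"
      unfolding slack_def fl using False by (auto simp: s'_def)
    then show ?thesis using sum sumG by simp
  qed
qed

text \<open>
  Every other occupied counter is active, starting with the lowest one, and slopes decrease; hence
  the active counters account for at least half of the total slope of all occupied counters.
\<close>

lemma occupied_le_active:
  assumes v: "valid s" and quiet: "\<not> match_due s" and j: "j \<le> K"
  shows "(\<Sum>k\<in>{1..j}. if \<exists>r. status s r = At k then \<alpha> k else 0) \<le>
    (\<Sum>k\<in>{1..j}. if active s k then 2 * \<alpha> k else 0) - (if odd (card (lower s (Suc j))) then \<alpha> j else 0)"
  using j
proof (induction j)
  case 0
  show ?case by (simp add: lower_def)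
next
  case (Suc j)
  have p: "Suc j \<in> pieces d" using pieces_down[OF K] Suc.prems by simp
  have le: "\<alpha> (Suc j) \<le> \<alpha> j" if "odd (card (lower s (Suc j)))"
  proof -
    have "j \<noteq> 0"
    proof
      assume "j = 0"
      with that show False by (simp add: lower_def)
    qed
    then show ?thesis using slope_antimono[OF p, of j] by simp
  qed
  \<comment> \<open>If the count up to \<open>j\<close> is odd, an occupied counter
    \<open>Suc j\<close> is inactive; its slope is paid by the subtracted \<open>\<alpha> j\<close>,
    which vanishes as the count becomes even.\<close>
  show ?case
  proof (cases "\<exists>r. status s r = At (Suc j)")
    case True
    then obtain r where r: "status s r = At (Suc j)" by blast
    have "card (lower s (Suc (Suc j))) = Suc (card (lower s (Suc j)))"
      using lower_Suc[OF quiet r] finite_lower[OF v] by simp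
    then show ?thesis using True Suc le by (auto simp: active_iff)
  next
    case False
    then show ?thesis using Suc le slope_pos[OF p]
      by (auto simp: active_iff lower_Suc_empty)
  qed
qed

text \<open>While counter \<open>k\<close> is active, \<open>3 * budget s k - counter s k\<close>
  grows at least at rate \<open>2 * \<alpha> k\<close>, which pays for the paused counters too. The
  withheld value \<open>counter s k\<close> is released by the reset and pays for the move. The
  first clause keeps the slack from being positive at infinite capacity.\<close>

definition within_budget :: "sla_state \<Rightarrow> bool" where
  "within_budget s \<longleftrightarrow> (\<forall>k\<in>pieces d. flipped s k \<longrightarrow> capacity x \<alpha> k \<noteq> \<infinity>) \<and>
     (now s \<le> T \<longrightarrow> (\<Sum>r<n. accrued s r) \<le> (\<Sum>k\<in>{1..K}. 3 * budget s k - counter s k))"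

section \<open>Preservation of the cost bound along a run\<close>

lemma pieces_K: "k \<in> {1..K} \<Longrightarrow> k \<in> pieces d"
  using pieces_down[OF K] by simp

lemma level_le_K:
  assumes v: "valid s" and c: "counters_valid s" and T: "now s \<le> T" and st: "status s r = At k"
  shows "k \<in> {1..K}"
proof -
  have k: "k \<in> pieces d" using validD(2)[OF v st] by simp
  have "0 \<le> counter s k / \<alpha> k" using counters_validD(1)[OF c] slope_pos[OF k] by simp
  moreover have "X (k - 1) + counter s k / \<alpha> k \<le> now s" using counters_validD(3)[OF c k] st by blast
  ultimately have "X (k - 1) \<le> T" using T by linarith
  then show ?thesis using K_bound[OF k] pieces_ge_1[OF k] by simp
qed

text \<open>With no match due, each occupied counter holds exactly one request, so the sum over
  requests becomes one over occupied counters.\<close>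

lemma sum_accrued_elapse:
  fixes \<delta> :: real
  assumes v: "valid s" and c: "counters_valid s" and T: "now s \<le> T" and quiet: "\<not> match_due s"
  defines "s' \<equiv> s\<lparr>now := now s + \<delta>,
         counter := (\<lambda>k. if active s k then counter s k + \<alpha> k * \<delta> else counter s k)\<rparr>"
  shows "(\<Sum>r<n. accrued s' r) =
     (\<Sum>r<n. accrued s r) + (\<Sum>k\<in>{1..K}. if \<exists>r. status s r = At k then \<alpha> k else 0) * \<delta>"
proof -
  have occupied: "(\<Sum>r<n. if status s r = At k then \<alpha> k * \<delta> else 0)
      = (if \<exists>r. status s r = At k then \<alpha> k else 0) * \<delta>" for k
  proof (cases "\<exists>r. status s r = At k")
    case True
    then obtain r where r: "status s r = At k" by blast
    have "status s r' = At k \<longleftrightarrow> r' = r" for r' using r quiet by (auto simp: match_due_def)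
    then show ?thesis using at_less_n[OF v r] True by simp
  qed simp
  have "accrued s' r = accrued s r + (\<Sum>k\<in>{1..K}. if status s r = At k then \<alpha> k * \<delta> else 0)" for r
  proof (cases "status s r")
    case (At k)
    have "(\<Sum>j\<in>{1..K}. if status s r = At j then \<alpha> j * \<delta> else 0) = \<alpha> k * \<delta>"
      using level_le_K[OF v c T At] by (simp add: At)
    with At show ?thesis by (simp add: accrued_def s'_def algebra_simps)
  qed (simp_all add: accrued_def s'_def)
  then have "(\<Sum>r<n. accrued s' r) =
      (\<Sum>r<n. accrued s r) + (\<Sum>r<n. \<Sum>k\<in>{1..K}. if status s r = At k then \<alpha> k * \<delta> else 0)"
    by (simp add: sum.distrib)
  also have "(\<Sum>r<n. \<Sum>k\<in>{1..K}. if status s r = At k then \<alpha> k * \<delta> else 0)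
      = (\<Sum>k\<in>{1..K}. \<Sum>r<n. if status s r = At k then \<alpha> k * \<delta> else 0)"
    by (rule sum.swap)
  finally show ?thesis by (simp only: occupied sum_distrib_right)
qed

lemma sum_less_n_upd:
  fixes g h :: "nat \<Rightarrow> real"
  assumes "r < n" "\<And>i. i \<noteq> r \<Longrightarrow> h i = g i"
  shows "(\<Sum>i<n. h i) = (\<Sum>i<n. g i) + (h r - g r)"
proof -
  have "(\<Sum>i<n. h i - g i) = (\<Sum>i<n. if i = r then h r - g r else 0)"
    using assms(2) by (intro sum.cong) auto
  then show ?thesis using assms(1) by (simp add: sum_subtractf)
qed

lemma within_budget_step:
  assumes st: "step s s'" and v: "valid s" and c: "counters_valid s" and b: "within_budget s"
  shows "within_budget s'"
  using st
proof cases
  case (match r r' k)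
  note bm = budget_match[OF v match(2-4), folded match(1)]
  have "accrued s' i \<le> accrued s i" for i
  proof (cases "i \<in> {r, r'}")
    case True
    then have i: "status s i = At k" using match by auto
    \<comment> \<open>A match replaces the tangent bound by the true cost.\<close>
    have "f (now s - a i) \<le> accrued s i"
      using f_tangent[of k "now s - a i"] validD(2)[OF v i] by (simp add: accrued_def i)
    moreover have "accrued s' i = f (now s - a i)" using True match(2) by (auto simp: accrued_def match(1))
    ultimately show ?thesis by simp
  next
    case False
    then show ?thesis by (cases "status s i") (simp_all add: accrued_def match(1))
  qed
  then have "(\<Sum>i<n. accrued s' i) \<le> (\<Sum>i<n. accrued s i)" by (intro sum_mono)
  moreover have "now s' = now s" "counter s' = counter s" by (simp_all add: match(1))
  ultimately show ?thesis using b unfolding within_budget_def bm by (auto intro: order_trans)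
next
  case (move r k)
  note bm = budget_move[OF v c move(2-4), folded move(1)]
  note facts = move_facts[OF v c move(2-4)]
  have r: "r < n" using at_less_n[OF v move(3)] .
  have cs: "counter s' j = (if j = k then 0 else counter s j)" for j by (simp add: move(1))
  have cap: "capacity x \<alpha> k \<noteq> \<infinity>" using capacity_finite[OF facts(2) pieces_ge_1[OF facts(1)]] .
  have "(\<Sum>i<n. accrued s' i) \<le> (\<Sum>j\<in>{1..K}. 3 * budget s' j - counter s' j)" if T: "now s \<le> T"
  proof -
    have kK: "k \<in> {1..K}" using level_le_K[OF v c T move(3)] .
    \<comment> \<open>The constant part rises by \<open>y k\<close>, which the reset of the counter
      releases; the linear part does not rise, since slopes decrease.\<close>
    have "\<alpha> (Suc k) * (now s - a r) \<le> \<alpha> k * (now s - a r)"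
      using slope_antimono[OF facts(2), of k] pieces_ge_1[OF facts(1)] validD(2)[OF v move(3)]
      by (intro mult_right_mono) auto
    then have "accrued s' r - accrued s r \<le> y k"
      using kK by (simp add: accrued_def move)
    moreover have "(\<Sum>i<n. accrued s' i) = (\<Sum>i<n. accrued s i) + (accrued s' r - accrued s r)"
      by (rule sum_less_n_upd[OF r]) (simp add: accrued_def move(1) split: status.split)
    moreover have "(\<Sum>j\<in>{1..K}. 3 * budget s' j - counter s' j)
        = (\<Sum>j\<in>{1..K}. (3 * budget s j - counter s j) + (if j = k then y k else 0))"
      using facts(3) by (intro sum.cong) (auto simp: bm(2) cs)
    then have "(\<Sum>j\<in>{1..K}. 3 * budget s' j - counter s' j)
        = (\<Sum>j\<in>{1..K}. 3 * budget s j - counter s j) + y k"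
      unfolding sum.distrib using kK by simp
    moreover have "(\<Sum>i<n. accrued s i) \<le> (\<Sum>j\<in>{1..K}. 3 * budget s j - counter s j)"
      using b T by (simp add: within_budget_def)
    ultimately show ?thesis by linarith
  qed
  moreover have "now s' = now s" by (simp add: move(1))
  ultimately show ?thesis using b cap unfolding within_budget_def bm(1) by auto
next
  case (arrive r)
  have fl: "flipped s k \<longrightarrow> capacity x \<alpha> k \<noteq> \<infinity>" if "k \<in> pieces d" for k
    using b that by (simp add: within_budget_def)
  note bm = budget_arrive[OF v c arrive(4,5) _ fl, folded arrive(1)]
  have cs: "counter s' = counter s" by (simp add: arrive(1))
  have "(\<Sum>i<n. accrued s' i) = (\<Sum>i<n. accrued s i) + (accrued s' r - accrued s r)"
    by (rule sum_less_n_upd[OF arrive(4)]) (simp add: accrued_def arrive(1) split: status.split)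
  \<comment> \<open>At arrival the age is 0 and the sum over lower counters is empty.\<close>
  also have "accrued s' r - accrued s r = 0" using arrive by (simp add: accrued_def)
  finally have "(\<Sum>i<n. accrued s' i) = (\<Sum>i<n. accrued s i)" by simp
  moreover have "(\<Sum>j\<in>{1..K}. 3 * budget s j - counter s j) \<le> (\<Sum>j\<in>{1..K}. 3 * budget s' j - counter s' j)"
    using bm(2) pieces_K by (intro sum_mono) (simp add: cs)
  moreover have "now s' = now s" by (simp add: arrive(1))
  ultimately show ?thesis using b bm(1) unfolding within_budget_def by auto
next
  case (elapse \<delta>)
  note bm = budget_elapse[OF v elapse(2,4,5), folded elapse(1)]
  have cs: "counter s' k = (if active s k then counter s k + \<alpha> k * \<delta> else counter s k)" for k
    by (simp add: elapse(1))
  have "(\<Sum>i<n. accrued s' i) \<le> (\<Sum>j\<in>{1..K}. 3 * budget s' j - counter s' j)" if "now s' \<le> T"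
  proof -
    have T: "now s \<le> T" using that elapse(4) by (simp add: elapse(1))
    have "(\<Sum>k\<in>{1..K}. if \<exists>r. status s r = At k then \<alpha> k else 0)
        \<le> (\<Sum>k\<in>{1..K}. if active s k then 2 * \<alpha> k else 0)"
      using occupied_le_active[OF v elapse(2) order_refl] slope_pos[OF K] by (auto split: if_splits)
    then have "(\<Sum>i<n. accrued s' i) \<le>
        (\<Sum>i<n. accrued s i) + (\<Sum>k\<in>{1..K}. if active s k then 2 * \<alpha> k else 0) * \<delta>"
      using sum_accrued_elapse[OF v c T elapse(2), of \<delta>, folded elapse(1)] elapse(4)
      by (simp add: mult_right_mono)
    also have "\<dots> \<le> (\<Sum>k\<in>{1..K}. 3 * budget s k - counter s k)
        + (\<Sum>k\<in>{1..K}. if active s k then 2 * \<alpha> k else 0) * \<delta>"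
      using b T by (simp add: within_budget_def)
    also have "\<dots> = (\<Sum>k\<in>{1..K}. 3 * budget s k - counter s k + (if active s k then 2 * \<alpha> k else 0) * \<delta>)"
      by (simp only: sum.distrib sum_distrib_right)
    also have "\<dots> \<le> (\<Sum>k\<in>{1..K}. 3 * budget s' k - counter s' k)"
    proof (rule sum_mono)
      fix k assume "k \<in> {1..K}"
      note bm(2)[OF pieces_K[OF this]]
      then show "3 * budget s k - counter s k + (if active s k then 2 * \<alpha> k else 0) * \<delta>
          \<le> 3 * budget s' k - counter s' k"
        by (auto simp: cs algebra_simps split: if_splits)
    qed
    finally show ?thesis .
  qed
  then show ?thesis using b bm(1) unfolding within_budget_def by auto
qed

lemma within_budget_init: "within_budget sla_init"
proof -
  have "overlap 0 r = 0" if "r \<in> short k" for r k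
  proof -
    have "r < n" using that by (simp add: short_def)
    then show ?thesis using partner[of r] inst by (simp add: overlap_def mpmd_instance_def)
  qed
  then show ?thesis
    by (simp add: within_budget_def sla_init_def flipped_def lower_def arrived_def budget_def
        slack_def accrued_def)
qed

section \<open>Comparison with the offline cost\<close>

lemma reachable_within_budget:
  assumes "sla_reachable x \<alpha> n a s"
  shows "within_budget s"
proof -
  have "valid s \<and> counters_valid s \<and> within_budget s"
    using assms unfolding sla_reachable_def
  proof (induction rule: rtranclp_induct)
    case base
    show ?case using valid_init counters_valid_init within_budget_init by blast
  next
    case (step s s')
    then show ?case using valid_step counters_valid_step within_budget_step by blast
  qed
  then show ?thesis by blast
qed

text \<open>The slack is never positive and overlaps are at most the gaps. What remains is
  \<open>\<alpha> k * gap r\<close> for short and \<open>y k\<close> for long requests, the two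
  cases of \<open>trunc\<close>.\<close>

lemma budget_le:
  assumes k: "k \<in> pieces d" and c: "counters_valid s" and b: "within_budget s"
  shows "budget s k \<le> (\<Sum>r<n. trunc k (gap r))"
proof -
  have "slack s k \<le> 0"
  proof (cases "flipped s k")
    case True
    then have "capacity x \<alpha> k \<noteq> \<infinity>" using b k by (simp add: within_budget_def)
    then have "counter s k \<le> y k" using counters_validD(2)[OF c k] capacity_iff(2)[OF k] by blast
    with True show ?thesis by (simp add: slack_def)
  qed (use counters_validD(1)[OF c] in \<open>simp add: slack_def\<close>)
  moreover have "(\<Sum>r\<in>short k. overlap (now s) r) \<le> (\<Sum>r\<in>short k. gap r)"
    by (intro sum_mono) (simp add: overlap_def gap_def overlap_le)
  then have "\<alpha> k * (\<Sum>r\<in>short k. overlap (now s) r) \<le> \<alpha> k * (\<Sum>r\<in>short k. gap r)"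
    using slope_pos[OF k] by (intro mult_left_mono) auto
  moreover have "y k * card (long k \<inter> arrived s) \<le> y k * card (long k)"
    using y_nonneg[OF k] by (intro mult_left_mono) (auto intro: card_mono)
  moreover have "(\<Sum>r<n. trunc k (gap r)) = (\<Sum>r\<in>short k. trunc k (gap r)) + (\<Sum>r\<in>long k. trunc k (gap r))"
    unfolding short_def by (rule sum.subset_diff) (auto simp: long_def)
  moreover have "(\<Sum>r\<in>short k. trunc k (gap r)) = \<alpha> k * (\<Sum>r\<in>short k. gap r)"
    unfolding sum_distrib_left by (rule sum.cong) (auto simp: short_def long_def trunc_def)
  moreover have "(\<Sum>r\<in>long k. trunc k (gap r)) = (\<Sum>r\<in>long k. y k)"
    by (rule sum.cong) (auto simp: long_def trunc_def)
  ultimately show ?thesis by (simp add: budget_def mult.commute)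
qed

lemma result_le:
  assumes r: "sla_reachable x \<alpha> n a s" and res: "sla_result n s p m" and T: "now s \<le> T"
  shows "cost f n a m \<le> 9 * (\<Sum>r<n. f (gap r))"
proof -
  note c = reachable_valid(2)[OF r] and b = reachable_within_budget[OF r]
  have "cost f n a m = (\<Sum>r<n. accrued s r)"
    using res unfolding cost_def by (intro sum.cong) (auto simp: accrued_def sla_result_def)
  also have "\<dots> \<le> (\<Sum>k\<in>{1..K}. 3 * budget s k - counter s k)"
    using b T by (simp add: within_budget_def)
  also have "\<dots> \<le> (\<Sum>k\<in>{1..K}. 3 * (\<Sum>r<n. trunc k (gap r)))"
  proof (rule sum_mono)
    fix k assume "k \<in> {1..K}"
    then show "3 * budget s k - counter s k \<le> 3 * (\<Sum>r<n. trunc k (gap r))"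
      using budget_le[OF pieces_K c b] counters_validD(1)[OF c, of k] by fastforce
  qed
  also have "\<dots> = 3 * (\<Sum>r<n. \<Sum>k\<in>{1..K}. trunc k (gap r))"
    by (simp only: sum_distrib_left[symmetric] sum.swap[of _ "{1..K}"])
  also have "\<dots> \<le> 3 * (\<Sum>r<n. 3 * f (gap r))"
    using sum_trunc_le[OF K] by (intro mult_left_mono sum_mono) (simp_all add: gap_def)
  finally show ?thesis by (simp add: sum_distrib_left[symmetric])
qed

text \<open>A pair is matched after its later arrival, so its earlier request waits at least the
  gap. Each wait is charged for both requests of the pair, hence the factor 2.\<close>

lemma sum_gap_le:
  assumes mono: "mono_on {0..} D" and nonneg: "\<And>t. 0 \<le> t \<Longrightarrow> 0 \<le> D t"
  shows "(\<Sum>r<n. D (gap r)) \<le> 2 * cost D n a \<mu>"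
proof -
  let ?w = "\<lambda>r. D (\<mu> r - a r)"
  have "D (gap r) \<le> ?w r + ?w (q r)" if r: "r < n" for r
  proof -
    have w: "0 \<le> \<mu> r - a r" "0 \<le> \<mu> (q r) - a (q r)"
      using wait_nonneg r partner[OF r] by auto
    have "gap r \<le> \<mu> r - a r \<or> gap r \<le> \<mu> (q r) - a (q r)"
      using w partner_time[OF r] by (auto simp: gap_def abs_if)
    moreover have "0 \<le> gap r" by (simp add: gap_def)
    ultimately have "D (gap r) \<le> ?w r \<or> D (gap r) \<le> ?w (q r)"
      using w by (auto intro!: mono_onD[OF mono])
    with nonneg[OF w(1)] nonneg[OF w(2)] show ?thesis by linarith
  qed
  then have "(\<Sum>r<n. D (gap r)) \<le> (\<Sum>r<n. ?w r) + (\<Sum>r<n. ?w (q r))"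
    unfolding sum.distrib[symmetric] by (intro sum_mono) auto
  also have "(\<Sum>r<n. ?w (q r)) = (\<Sum>r<n. ?w r)"
    by (rule sum.reindex_bij_witness[of _ q q]) (use partner in auto)
  finally show ?thesis by (simp add: cost_def)
qed

end

text \<open>The constant is \<open>2 * 9 * 2\<close>, from \<open>D t \<le> 2 * f t\<close>,
  \<open>result_le\<close> and \<open>sum_gap_le\<close>.\<close>

lemma (in sla) cost_le:
  assumes mono: "mono_on {0..} D" and D: "\<forall>t\<ge>0. f t \<le> D t \<and> D t \<le> 2 * f t"
    and nonneg: "\<And>t. 0 \<le> t \<Longrightarrow> 0 \<le> D t"
    and r: "sla_reachable x \<alpha> n a s" and res: "sla_result n s p m" and sol: "solution n a q \<mu>"
  shows "cost D n a m \<le> 36 * cost D n a \<mu>"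
proof -
  \<comment> \<open>The maximum with 0 meets the premise of \<open>levels_bounded\<close>.\<close>
  obtain K where K: "K \<in> pieces d" "\<And>k. k \<in> pieces d \<Longrightarrow> X (k - 1) \<le> max 0 (now s) \<Longrightarrow> k \<le> K"
    using levels_bounded[of "max 0 (now s)"] by auto
  interpret offline d x \<alpha> f n a q \<mu> "max 0 (now s)" K
    using sol K by unfold_locales
  have "a i \<le> m i" if "i < n" for i
    using result_solution[OF reachable_valid(1)[OF r] res] that by (simp add: solution_def)
  then have "cost D n a m \<le> 2 * cost f n a m"
    unfolding cost_def sum_distrib_left using D by (intro sum_mono) auto
  also have "\<dots> \<le> 18 * (\<Sum>i<n. f (gap i))" using result_le[OF r res] by simp
  also have "\<dots> \<le> 18 * (\<Sum>i<n. D (gap i))"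
    using D by (intro mult_left_mono sum_mono) (auto simp: gap_def)
  also have "\<dots> \<le> 36 * cost D n a \<mu>" using sum_gap_le[OF mono nonneg] by simp
  finally show ?thesis .
qed

theorem theorem2:
  "\<exists>C::real. \<forall>(D :: real \<Rightarrow> real) (f :: real \<Rightarrow> real) d x \<alpha>.
     admissible_delay D \<and> exp_decreasing_pwl d x \<alpha> f \<and> (\<forall>t\<ge>0. f t \<le> D t \<and> D t \<le> 2 * f t) \<longrightarrow>
     (\<forall>n a. mpmd_instance n a \<longrightarrow>
        sla_completes x \<alpha> n a \<and>
        (\<forall>s p m. sla_reachable x \<alpha> n a s \<and> sla_result n s p m \<longrightarrow>
           solution n a p m \<and> cost D n a m \<le> C * opt_cost D n a))"
proof (intro exI[of _ 36] allI impI)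
  fix D f :: "real \<Rightarrow> real" and d x \<alpha> n a
  assume A: "admissible_delay D \<and> exp_decreasing_pwl d x \<alpha> f \<and> (\<forall>t\<ge>0. f t \<le> D t \<and> D t \<le> 2 * f t)"
    and "mpmd_instance n a"
  then interpret sla d x \<alpha> f n a by unfold_locales auto
  have D: "mono_on {0..} D" "\<And>t. 0 \<le> t \<Longrightarrow> 0 \<le> D t"
    using A by (auto simp: admissible_delay_def)
  have "solution n a p m \<and> cost D n a m \<le> 36 * opt_cost D n a"
    if r: "sla_reachable x \<alpha> n a s" "sla_result n s p m" for s p m
  proof
    show p: "solution n a p m" using result_solution[OF reachable_valid(1)[OF r(1)] r(2)] .
    \<comment> \<open>The bound holds against every solution, so no minimiser has to be exhibited;
      the solution of the algorithm shows that the set is nonempty.\<close>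
    have "cost D n a m / 36 \<le> opt_cost D n a"
      unfolding opt_cost_def
    proof (rule cInf_greatest)
      show "{cost D n a m |p m. solution n a p m} \<noteq> {}" using p by blast
    next
      fix c assume "c \<in> {cost D n a m |p m. solution n a p m}"
      then obtain q \<mu> where q: "solution n a q \<mu>" "c = cost D n a \<mu>" by blast
      show "cost D n a m / 36 \<le> c"
        using cost_le[OF D(1) _ D(2) r q(1)] A q(2) by simp
    qed
    then show "cost D n a m \<le> 36 * opt_cost D n a" by simp
  qed
  then show "sla_completes x \<alpha> n a \<and>
        (\<forall>s p m. sla_reachable x \<alpha> n a s \<and> sla_result n s p m \<longrightarrow>
           solution n a p m \<and> cost D n a m \<le> 36 * opt_cost D n a)"
    using sla_completes by blast
qed

end
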